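(* Let $(i)_2^{\mathrm r}$ denote the reverse of the binary representation of $i\in\mathbb N$, and let $$L_{rev\text{-}bins}=\{a\,(0)_2^{\mathrm r}\,a\,(1)_2^{\mathrm r}\,a\cdots a\,(k)_2^{\mathrm r}\,a \mid k\in\mathbb Z^+\}$$ over the alphabet $\{a,0,1\}$. Then there is a realtime quantum finite automaton with (two-way) write-only memory (RT-QFA-WOM) $\mathcal M$ that recognizes $L_{rev\text{-}bins}$ with negative one-sided error bound $\frac34$ and whose WOM usage on inputs that are members of $L_{rev\text{-}bins}$ is $O(\log n)$, where $n$ is the length of the input string.
   Context: Realtime processing: for an input $w\in\Sigma^*$ (where $\Sigma$ is a finite alphabet not containing the end-markers ¢, \$), the input tape contains $\tilde w=$ ¢$w$\$. The machine reads $\tilde w$ from left to right, one symbol per step, and decides right after reading \$. Put $\tilde\Sigma=\Sigma\cup\{\text{¢},\$\}$. RT-QFA-WOM: a tuple $(Q,\Sigma,\Gamma,\Omega,\delta,q_1,Q_a)$ with finite state set $Q$, initial state $q_1$, accepting states $Q_a\subseteq Q$, finite register alphabet $\Omega$, and a finite alphabet $\Gamma$ for the write-only memory (WOM) tape, containing the blank symbol $\#$ and the empty symbol $\varepsilon$. The WOM tape is a two-way tape that is never read. In state $q$ reading $\sigma\in\tilde\Sigma$, the machine moves to $q'$, writes $\gamma\in\Gamma$ on the WOM tape square under the WOM head (writing $\varepsilon$ leaves the square unchanged), moves the WOM head in direction $d\in\{\leftarrow,\downarrow,\rightarrow\}$ (one square left, stay, one square right), and writes $\omega\in\Omega$ in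 the register, with amplitude $\delta(q,\sigma,q',\gamma,d,\omega)\in\mathbb C$. A configuration consists of the state, the input head position, the content of the WOM tape and the WOM head position (the register is not part of it, and is reset to a fixed initial symbol before every step). For a given input let $\mathcal C$ be the set of attainable configurations, and for $\omega\in\Omega$ let $E_\omega$ be the matrix of one-step amplitudes between configurations with $\omega$ written in the register. The machine must be well-formed: $\sum_{\omega}E_\omega^\dagger E_\omega=I$ for every input. The state evolves from the initial configuration (WOM tape blank) by $\rho\mapsto\sum_\omega E_\omega\rho E_\omega^\dagger$ in each step, and $f_{\mathcal M}(w)$ is the probability that, after \$ is processed, a measurement of the internal state gives a state in $Q_a$. $L$ is recognized by $\mathcal M$ with negative one-sided error bound $\epsilon\in[0,1)$ if $f_{\mathcal M}(w)=1$ for all $w\in L$ and $f_{\mathcal M}(w)\le\epsilon$ for all $w\in\Sigma^*\setminus L$. WOM usage on an input: the (maximum, over computation paths) number of squares of the WOM tape used by the machine on that input. Binary representations have no leading zeros, except that $0$ is represented by the string "0". *)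

theory Defs
  imports Complex_Main "HOL-Library.Landau_Symbols"
begin

section \<open>Realtime quantum finite automata with write-only memory\<close>

text \<open>The end-markers, the blank and the empty symbol are constructors of their own, so that
  they are distinct from all other symbols by construction.\<close>

datatype 's tsym = LeftEnd | Sym 's | RightEnd

datatype 'g wsym = Blank | Empty | WSym 'g

datatype dir = MoveLeft | Stay | MoveRight

definition padded :: "'s list \<Rightarrow> 's tsym list" where
  "padded w = LeftEnd # map Sym w @ [RightEnd]"

record ('q, 's, 'g, 'o) rtqfa_wom =
  states :: "'q set"
  input_alph :: "'s set"
  wom_alph :: "'g wsym set"
  reg_alph :: "'o set"
  delta :: "'q \<Rightarrow> 's tsym \<Rightarrow> 'q \<Rightarrow> 'g wsym \<Rightarrow> dir \<Rightarrow> 'o \<Rightarrow> complex"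
  start :: 'q
  accepting :: "'q set"

text \<open>The WOM tape is infinite in both directions. The input head position is the number of
  symbols of the padded input already read.\<close>

datatype ('q, 'g) config =
  Config (cstate: 'q) (input_pos: nat) (wom_tape: "int \<Rightarrow> 'g wsym") (wom_pos: int)

definition initial_config :: "('q, 's, 'g, 'o) rtqfa_wom \<Rightarrow> ('q, 'g) config" where
  "initial_config M = Config (start M) 0 (\<lambda>_. Blank) 0"

definition wom_write :: "(int \<Rightarrow> 'g wsym) \<Rightarrow> int \<Rightarrow> 'g wsym \<Rightarrow> (int \<Rightarrow> 'g wsym)" where
  "wom_write t p g = (if g = Empty then t else t(p := g))"

definition shift :: "dir \<Rightarrow> int" where
  "shift d = (case d of MoveLeft \<Rightarrow> -1 | Stay \<Rightarrow> 0 | MoveRight \<Rightarrow> 1)"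

text \<open>\<open>amp M w r c' c\<close> is the entry of the matrix \<open>E\<^sub>r\<close> in row \<open>c'\<close> and column \<open>c\<close>. Several
  symbols may lead from \<open>c\<close> to the same \<open>c'\<close> (for instance, \<open>Blank\<close> and \<open>Empty\<close> written on a
  blank square); their amplitudes add up. No step leaves a configuration in which the whole
  padded input has been read. Values of \<open>delta\<close> outside the alphabets and the state set of the
  machine are ignored, here and in all sums over the register alphabet below.\<close>

definition amp :: "('q, 's, 'g, 'o) rtqfa_wom \<Rightarrow> 's list \<Rightarrow> 'o
    \<Rightarrow> ('q, 'g) config \<Rightarrow> ('q, 'g) config \<Rightarrow> complex" where
  "amp M w r c' c =
    (if input_pos c < length (padded w) \<and> input_pos c' = Suc (input_pos c)
        \<and> cstate c \<in> states M \<and> cstate c' \<in> states M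
     then \<Sum>g\<in>wom_alph M. \<Sum>d\<in>{MoveLeft, Stay, MoveRight}.
       (if wom_tape c' = wom_write (wom_tape c) (wom_pos c) g
           \<and> wom_pos c' = wom_pos c + shift d
        then delta M (cstate c) (padded w ! input_pos c) (cstate c') g d r
        else 0)
     else 0)"

definition one_step :: "('q, 's, 'g, 'o) rtqfa_wom \<Rightarrow> 's list
    \<Rightarrow> ('q, 'g) config \<Rightarrow> ('q, 'g) config \<Rightarrow> bool" where
  "one_step M w c c' \<longleftrightarrow> (\<exists>r\<in>reg_alph M. amp M w r c' c \<noteq> 0)"

definition attainable :: "('q, 's, 'g, 'o) rtqfa_wom \<Rightarrow> 's list \<Rightarrow> ('q, 'g) config set" where
  "attainable M w = {c. (one_step M w)\<^sup>*\<^sup>* (initial_config M) c}"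

text \<open>The columns of the matrices that belong to configurations in which the whole padded input
  has been read are not subject to the condition: the machine has halted there.\<close>

definition well_formed :: "('q, 's, 'g, 'o) rtqfa_wom \<Rightarrow> bool" where
  "well_formed M \<longleftrightarrow>
    (\<forall>w\<in>lists (input_alph M).
      \<forall>c\<in>attainable M w. \<forall>c'\<in>attainable M w.
        input_pos c < length (padded w) \<longrightarrow> input_pos c' < length (padded w) \<longrightarrow>
        (\<Sum>r\<in>reg_alph M. \<Sum>b\<in>attainable M w. cnj (amp M w r b c) * amp M w r b c')
          = (if c = c' then 1 else 0))"

definition is_rtqfa_wom :: "('q, 's, 'g, 'o) rtqfa_wom \<Rightarrow> bool" where
  "is_rtqfa_wom M \<longleftrightarrow>
    finite (states M) \<and> finite (input_alph M) \<and> finite (wom_alph M) \<and> finite (reg_alph M)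
    \<and> Blank \<in> wom_alph M \<and> Empty \<in> wom_alph M
    \<and> start M \<in> states M \<and> accepting M \<subseteq> states M
    \<and> well_formed M"

definition initial_density :: "('q, 's, 'g, 'o) rtqfa_wom
    \<Rightarrow> ('q, 'g) config \<Rightarrow> ('q, 'g) config \<Rightarrow> complex" where
  "initial_density M c c' = (if c = initial_config M \<and> c' = initial_config M then 1 else 0)"

definition evolve :: "('q, 's, 'g, 'o) rtqfa_wom \<Rightarrow> 's list
    \<Rightarrow> (('q, 'g) config \<Rightarrow> ('q, 'g) config \<Rightarrow> complex)
    \<Rightarrow> ('q, 'g) config \<Rightarrow> ('q, 'g) config \<Rightarrow> complex" where
  "evolve M w \<rho> c c' =
    (\<Sum>r\<in>reg_alph M. \<Sum>b\<in>attainable M w. \<Sum>b'\<in>attainable M w.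
      amp M w r c b * \<rho> b b' * cnj (amp M w r c' b'))"

definition final_density :: "('q, 's, 'g, 'o) rtqfa_wom \<Rightarrow> 's list
    \<Rightarrow> ('q, 'g) config \<Rightarrow> ('q, 'g) config \<Rightarrow> complex" where
  "final_density M w = (evolve M w ^^ length (padded w)) (initial_density M)"

text \<open>Diagonal entries of a density matrix are real; \<open>Re\<close> only changes the type.\<close>

definition accept_prob :: "('q, 's, 'g, 'o) rtqfa_wom \<Rightarrow> 's list \<Rightarrow> real" where
  "accept_prob M w =
    Re (\<Sum>c\<in>{c \<in> attainable M w. cstate c \<in> accepting M}. final_density M w c c)"

definition recognizes_neg_one_sided ::
    "('q, 's, 'g, 'o) rtqfa_wom \<Rightarrow> 's list set \<Rightarrow> real \<Rightarrow> bool" where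
  "recognizes_neg_one_sided M L \<epsilon> \<longleftrightarrow>
    0 \<le> \<epsilon> \<and> \<epsilon> < 1 \<and> L \<subseteq> lists (input_alph M)
    \<and> (\<forall>w\<in>L. accept_prob M w = 1)
    \<and> (\<forall>w\<in>lists (input_alph M) - L. accept_prob M w \<le> \<epsilon>)"

definition comp_path :: "('q, 's, 'g, 'o) rtqfa_wom \<Rightarrow> 's list \<Rightarrow> ('q, 'g) config list \<Rightarrow> bool" where
  "comp_path M w cs \<longleftrightarrow>
    length cs = Suc (length (padded w)) \<and> cs ! 0 = initial_config M
    \<and> (\<forall>i<length (padded w). one_step M w (cs ! i) (cs ! Suc i))"

text \<open>A square counts as used on a path if it is visited by the WOM head; in particular every
  square that is written on counts.\<close>

definition wom_usage :: "('q, 's, 'g, 'o) rtqfa_wom \<Rightarrow> 's list \<Rightarrow> nat" where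
  "wom_usage M w = Max {card (wom_pos ` set cs) | cs. comp_path M w cs}"


section \<open>The attainable configurations form a finite set\<close>

text \<open>Hence none of the sums over \<^const>\<open>attainable\<close>, and not the maximum in
  \<^const>\<open>wom_usage\<close>, ranges over an infinite set.\<close>

lemma one_step_cases:
  assumes "one_step M w c c'"
  shows "input_pos c < length (padded w)" "input_pos c' = Suc (input_pos c)"
    "\<exists>q\<in>states M. \<exists>g\<in>wom_alph M. \<exists>d\<in>{MoveLeft, Stay, MoveRight}.
      c' = Config q (Suc (input_pos c)) (wom_write (wom_tape c) (wom_pos c) g) (wom_pos c + shift d)"
proof -
  obtain r where r: "amp M w r c' c \<noteq> 0"
    using assms by (auto simp: one_step_def)
  show 1: "input_pos c < length (padded w)" and 2: "input_pos c' = Suc (input_pos c)"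
    using r by (auto simp: amp_def split: if_splits)
  have q: "cstate c' \<in> states M"
    using r by (auto simp: amp_def split: if_splits)
  have "(\<Sum>g\<in>wom_alph M. \<Sum>d\<in>{MoveLeft, Stay, MoveRight}.
       (if wom_tape c' = wom_write (wom_tape c) (wom_pos c) g
           \<and> wom_pos c' = wom_pos c + shift d
        then delta M (cstate c) (padded w ! input_pos c) (cstate c') g d r
        else 0)) \<noteq> 0"
    using r unfolding amp_def by metis
  then obtain g where g: "g \<in> wom_alph M" and
    "(\<Sum>d\<in>{MoveLeft, Stay, MoveRight}.
       (if wom_tape c' = wom_write (wom_tape c) (wom_pos c) g
           \<and> wom_pos c' = wom_pos c + shift d
        then delta M (cstate c) (padded w ! input_pos c) (cstate c') g d r
        else 0)) \<noteq> 0"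
    by (rule sum.not_neutral_contains_not_neutral)
  then obtain d where "d \<in> {MoveLeft, Stay, MoveRight}"
    "(if wom_tape c' = wom_write (wom_tape c) (wom_pos c) g
           \<and> wom_pos c' = wom_pos c + shift d
        then delta M (cstate c) (padded w ! input_pos c) (cstate c') g d r
        else 0) \<noteq> 0"
    using sum.not_neutral_contains_not_neutral by blast
  with g q 2 show "\<exists>q\<in>states M. \<exists>g\<in>wom_alph M. \<exists>d\<in>{MoveLeft, Stay, MoveRight}.
      c' = Config q (Suc (input_pos c)) (wom_write (wom_tape c) (wom_pos c) g) (wom_pos c + shift d)"
    by (metis config.collapse)
qed

lemma finite_attainable:
  assumes "finite (states M)" "finite (wom_alph M)"
  shows "finite (attainable M w)"
proof -
  define S where "S = (\<lambda>C :: ('a, 'c) config set. \<Union>c\<in>C. \<Union>q\<in>states M. \<Union>g\<in>wom_alph M.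
    (\<lambda>d. Config q (Suc (input_pos c)) (wom_write (wom_tape c) (wom_pos c) g) (wom_pos c + shift d))
      ` {MoveLeft, Stay, MoveRight})"
  have fin: "finite ((S ^^ n) {initial_config M})" for n
    by (induction n) (auto simp: S_def assms)
  have "input_pos c \<le> length (padded w) \<and> c \<in> (S ^^ input_pos c) {initial_config M}"
    if "(one_step M w)\<^sup>*\<^sup>* (initial_config M) c" for c
    using that
  proof (induction rule: rtranclp_induct)
    case base
    then show ?case by (simp add: initial_config_def)
  next
    case (step b c)
    have "c \<in> S ((S ^^ input_pos b) {initial_config M})"
      using one_step_cases(3)[OF step.hyps(2)] step.IH unfolding S_def by blast
    then show ?case
      using one_step_cases(1,2)[OF step.hyps(2)] by simp
  qed
  then have "attainable M w \<subseteq> (\<Union>n\<le>length (padded w). (S ^^ n) {initial_config M})"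
    by (auto simp: attainable_def)
  then show ?thesis
    by (rule finite_subset) (simp add: fin)
qed


section \<open>The language\<close>

datatype letter = LA | L0 | L1

definition digit :: "nat \<Rightarrow> letter" where
  "digit b = (if b = 0 then L0 else L1)"

fun bin :: "nat \<Rightarrow> letter list" where
  "bin n = (if n < 2 then [digit n] else bin (n div 2) @ [digit (n mod 2)])"

declare bin.simps [simp del]

definition L_rev_bins :: "letter list set" where
  "L_rev_bins = {concat (map (\<lambda>i. LA # rev (bin i)) [0..<Suc k]) @ [LA] | k. k \<ge> 1}"

end

theory Submission
  imports Defs "HOL-Library.Countable"
begin

text \<open>Cut the input at the letters \<open>a\<close> into \<open>y\<^sub>0 a y\<^sub>1 a \<dots>\<close>. It is a member iff it ends with \<open>a\<close>,
  contains at least three letters \<open>a\<close> (both checked by the finite control), and \<open>y\<^sub>0\<close> is empty,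
  \<open>y\<^sub>1 = 0\<close> and \<open>y\<^sub>n\<^sub>+\<^sub>1\<close> is the successor of \<open>y\<^sub>n\<close> for \<open>n \<ge> 1\<close>. The machine splits into two checks,
  which compare neighbouring blocks in pairs of either parity. Within a check, one path writes the
  successor of the first block of the pair on the WOM tape and the other path writes the second block;
  the successor is computable on the fly because the digits come least significant first. At the
  end of the pair a Hadamard transform lets the two paths interfere: equal configurations leave the
  machine in the accepting branch with certainty, different ones go to a rejecting state with
  probability 1/2. So a non-member is accepted with probability at most \<open>1/2 + 1/2 \<sqdot> 1/2\<close>.

  The amplitudes of symbols that lead to the same tape add up. Writing the two tape symbols with
  amplitude 1 and the empty symbol with amplitude \<open>-1\<close> therefore toggles a square, so that digits
  can be added to old tape contents reversibly and the same squares be used for all pairs. The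
  head moves to the right in one pair and to the left in the next, which keeps it within a distance
  of the origin bounded by the length of the longest block.\<close>

text \<open>In \<open>Run k x\<close> and \<open>Rej k\<close>, \<open>k\<close> is the check; \<open>x\<close> says whether the path writes the second
  block of each pair. The finite control \<open>(j, c, l)\<close> is the same on all paths: \<open>j\<close> is the number of
  the current block (beyond 6 only modulo 4), \<open>c\<close> the carry, \<open>l\<close> whether the last letter was \<open>a\<close>.\<close>

datatype path = Init | Run bool bool | Rej bool

instance path :: countable
  by countable_datatype

section \<open>Finite control, pairing of blocks and head directions\<close>

type_synonym ctrl = "nat \<times> bool \<times> bool"
type_synonym tape = "(int \<Rightarrow> nat wsym) \<times> int"

text \<open>Check \<open>k\<close> pairs block \<open>j\<close> with the next one when
  \<open>even j = k\<close>. In every block exactly one of its two paths is active.\<close>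

definition active :: "bool \<Rightarrow> bool \<Rightarrow> nat \<Rightarrow> bool" where
  "active k x j \<longleftrightarrow> even j = (k \<noteq> x)"

text \<open>The summand \<open>of_bool (\<not> k)\<close> aligns the halves with the pairs, which
  are blocks 2i, 2i+1 in check \<open>True\<close> and 2i-1, 2i in check
  \<open>False\<close>.\<close>

definition dirn :: "bool \<Rightarrow> nat \<Rightarrow> dir" where
  "dirn k j = (if even ((j + of_bool (\<not> k)) div 2) then MoveRight else MoveLeft)"

text \<open>Parity and direction depend on the block number modulo 4 and acceptance on whether it is
  at least 3, so the numbers may cycle through 3, 4, 5, 6; the successor 3 of 6 is congruent to
  7.\<close>

definition next_block :: "nat \<Rightarrow> nat" where
  "next_block j = (if j < 6 then Suc j else j - 3)"

fun ctrl_step :: "ctrl \<Rightarrow> letter tsym \<Rightarrow> ctrl" where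
  "ctrl_step (j, c, l) (Sym LA) = (next_block j, True, True)"
| "ctrl_step (j, c, l) (Sym L0) = (j, False, False)"
| "ctrl_step (j, c, l) (Sym L1) = (j, c, False)"
| "ctrl_step z _ = z"

text \<open>The toggle \<open>j \<noteq> 0\<close> at the end of block 0, which should be empty, produces the word \<open>0\<close> that
  block 1 is compared with.\<close>

fun instr :: "ctrl \<Rightarrow> path \<Rightarrow> letter tsym \<Rightarrow> bool \<times> dir" where
  "instr (j, c, l) (Run k x) (Sym LA) =
    (if active k x j \<and> \<not> x \<and> c then (j \<noteq> 0, dirn k j) else (False, Stay))"
| "instr (j, c, l) (Run k x) (Sym L0) =
    (if active k x j then (\<not> x \<and> c, dirn k j) else (False, Stay))"
| "instr (j, c, l) (Run k x) (Sym L1) =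
    (if active k x j then (x \<or> \<not> c, dirn k j) else (False, Stay))"
| "instr _ _ _ = (False, Stay)"

text \<open>Path \<open>True\<close> is active exactly in the second block of a pair, so this is the
  separator at which the pair is compared.\<close>

definition merges :: "bool \<Rightarrow> ctrl \<Rightarrow> letter tsym \<Rightarrow> bool" where
  "merges k z \<sigma> \<longleftrightarrow> \<sigma> = Sym LA \<and> active k True (fst z)"

text \<open>A path that was rejected earlier writes 1 in the register, since it may have the same
  configuration as a path that is rejected now.\<close>

fun coef :: "ctrl \<Rightarrow> letter tsym \<Rightarrow> path \<Rightarrow> path \<Rightarrow> nat \<Rightarrow> complex" where
  "coef z \<sigma> Init (Run k x) r = (if r = 0 then 1/2 else 0)"
| "coef z \<sigma> Init Init r = 0"
| "coef z \<sigma> Init (Rej k) r = 0"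
| "coef z \<sigma> (Run k x) (Run k' x') r =
    (if r = 0 \<and> k' = k then if merges k z \<sigma> then 1/2 else of_bool (x' = x) else 0)"
| "coef z \<sigma> (Run k x) (Rej k') r =
    (if r = 0 \<and> k' = k \<and> merges k z \<sigma> then (if x then -1 else 1) / sqrt 2 else 0)"
| "coef z \<sigma> (Run k x) Init r = 0"
| "coef z \<sigma> (Rej k) p r = of_bool (r = 1 \<and> p = Rej k)"

section \<open>Tape operations and the machine\<close>

definition flip :: "nat wsym \<Rightarrow> nat wsym" where
  "flip g = (if g = Blank then WSym 0 else Blank)"

definition put :: "bool \<Rightarrow> dir \<Rightarrow> tape \<Rightarrow> tape" where
  "put b d s = ((if b then (fst s)(snd s := flip (fst s (snd s))) else fst s), snd s + shift d)"

definition act :: "ctrl \<Rightarrow> path \<Rightarrow> letter tsym \<Rightarrow> tape \<Rightarrow> tape" where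
  "act z p \<sigma> s = put (fst (instr z p \<sigma>)) (snd (instr z p \<sigma>)) s"

fun write_amp :: "bool \<Rightarrow> nat wsym \<Rightarrow> complex" where
  "write_amp True Empty = -1"
| "write_amp True _ = 1"
| "write_amp False Empty = 1"
| "write_amp False _ = 0"

text \<open>The machine has states of type \<open>nat\<close>; countability supplies an injective
  code with left inverse \<open>dec\<close>.\<close>

definition enc :: "ctrl \<times> path \<Rightarrow> nat" where "enc = to_nat"
definition dec :: "nat \<Rightarrow> ctrl \<times> path" where "dec = from_nat"

lemma dec_enc [simp]: "dec (enc q) = q"
  by (simp add: dec_def enc_def)

lemma enc_eq_iff [simp]: "enc q = enc q' \<longleftrightarrow> q = q'"
  by (simp add: enc_def)

definition ctrls :: "ctrl set" where
  "ctrls = {..6} \<times> UNIV"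

definition delta\<^sub>M :: "nat \<Rightarrow> letter tsym \<Rightarrow> nat \<Rightarrow> nat wsym \<Rightarrow> dir \<Rightarrow> nat \<Rightarrow> complex" where
  "delta\<^sub>M q \<sigma> q' g d r =
    (let (z, p) = dec q; (z', p') = dec q'; (b, d') = instr z p \<sigma> in
      if z' = ctrl_step z \<sigma> \<and> d = d' then coef z \<sigma> p p' r * write_amp b g else 0)"

definition machine :: "(nat, letter, nat, nat) rtqfa_wom" where
  "machine = \<lparr>states = enc ` (ctrls \<times> UNIV), input_alph = {LA, L0, L1},
    wom_alph = {Blank, Empty, WSym 0}, reg_alph = {0, 1}, delta = delta\<^sub>M,
    start = enc ((0, True, False), Init),
    accepting = {enc ((j, c, True), Run k x) | j c k x. 3 \<le> j \<and> j \<le> 6}\<rparr>"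

lemma machine_simps [simp]:
  "states machine = enc ` (ctrls \<times> UNIV)" "input_alph machine = {LA, L0, L1}"
  "wom_alph machine = {Blank, Empty, WSym 0}" "reg_alph machine = {0, 1}"
  "delta machine = delta\<^sub>M" "start machine = enc ((0, True, False), Init)"
  by (simp_all add: machine_def)

lemma accepting_machine:
  "accepting machine = {enc ((j, c, True), Run k x) | j c k x. 3 \<le> j \<and> j \<le> 6}"
  by (simp add: machine_def)

section \<open>One-step amplitudes and their orthonormality\<close>

lemma UNIV_path: "UNIV = {Init, Run False False, Run False True, Run True False, Run True True,
  Rej False, Rej True}"
proof -
  have "p \<in> {Init, Run False False, Run False True, Run True False, Run True True,
    Rej False, Rej True}" for p
  proof (cases p)
    case (Run k x)
    then show ?thesis by (cases k; cases x) auto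
  next
    case (Rej k)
    then show ?thesis by (cases k) auto
  qed auto
  then show ?thesis by auto
qed

lemma finite_path [simp, intro]: "finite (A :: path set)"
  by (rule finite_subset[of _ UNIV]) (simp, simp add: UNIV_path)

lemma ctrl_step_in [simp]: "z \<in> ctrls \<Longrightarrow> ctrl_step z \<sigma> \<in> ctrls"
  by (cases "(z, \<sigma>)" rule: ctrl_step.cases) (auto simp: ctrls_def next_block_def)

text \<open>In a toggle, rewriting the old symbol and writing \<open>Empty\<close> give the same
  tape with amplitudes 1 and -1, which cancel; only the flipped symbol survives. The tape thus moves
  deterministically along each path, and all branching sits in \<open>coef\<close>.\<close>

lemma amp_machine:
  assumes "t x \<in> {Blank, WSym 0}"
  shows "amp machine w r (Config (enc (z', p')) i' t' x') (Config (enc (z, p)) i t x) =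
    (if i < length (padded w) \<and> i' = Suc i \<and> z \<in> ctrls
        \<and> z' = ctrl_step z (padded w ! i) \<and> (t', x') = act z p (padded w ! i) (t, x)
     then coef z (padded w ! i) p p' r else 0)"
proof -
  obtain b d where bd: "instr z p (padded w ! i) = (b, d)" by fastforce
  have act: "act z p (padded w ! i) (t, x) = put b d (t, x)"
    by (simp add: act_def bd)
  have split: "(\<Sum>d''\<in>{MoveLeft, Stay, MoveRight}.
     if T \<and> x' = x + shift d'' then (if d'' = d then C * write_amp b g else 0) else 0)
    = (if T \<and> x' = x + shift d then C * write_amp b g else 0)" for C T g
    by (cases d) auto
  have main: "(\<Sum>g\<in>{Blank, Empty, WSym 0}.
     if t' = wom_write t x g \<and> x' = x + shift d then C * write_amp b g else 0)
    = (if (t', x') = put b d (t, x) then C else 0)" for C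
  proof (cases b)
    case False
    then show ?thesis by (auto simp: wom_write_def put_def)
  next
    case True
    from assms consider "t x = Blank" | "t x = WSym 0" by auto
    then show ?thesis
    proof cases
      case 1
      then have "t(x := Blank) = t" "t(x := WSym 0) \<noteq> t"
        by (auto simp: fun_eq_iff)
      with True 1 show ?thesis by (auto simp: wom_write_def put_def flip_def)
    next
      case 2
      then have "t(x := WSym 0) = t" "t(x := Blank) \<noteq> t"
        by (auto simp: fun_eq_iff)
      with True 2 show ?thesis by (auto simp: wom_write_def put_def flip_def)
    qed
  qed
  show ?thesis
  proof (cases "i < length (padded w) \<and> i' = Suc i \<and> z \<in> ctrls \<and> z' = ctrl_step z (padded w ! i)")
    case True
    then have z: "z' = ctrl_step z (padded w ! i)" "z \<in> ctrls" "z' \<in> ctrls" by auto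
    have "amp machine w r (Config (enc (z', p')) i' t' x') (Config (enc (z, p)) i t x) =
      (\<Sum>g\<in>{Blank, Empty, WSym 0}. \<Sum>d''\<in>{MoveLeft, Stay, MoveRight}.
       if t' = wom_write t x g \<and> x' = x + shift d''
       then (if d'' = d then coef z (padded w ! i) p p' r * write_amp b g else 0) else 0)"
      unfolding amp_def using True z
      by (simp add: delta\<^sub>M_def bd image_iff cong: if_cong)
    also have "\<dots> = (if (t', x') = put b d (t, x) then coef z (padded w ! i) p p' r else 0)"
      by (simp only: split main)
    finally show ?thesis using True by (simp add: act)
  next
    case False
    have zero: "delta\<^sub>M (enc (z, p)) (padded w ! i) (enc (z', p')) g d'' r = 0"
      if "z' \<noteq> ctrl_step z (padded w ! i)" for g d''
      using that by (simp add: delta\<^sub>M_def bd)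
    from False consider "\<not> (i < length (padded w) \<and> i' = Suc i \<and> z \<in> ctrls)"
      | "z' \<noteq> ctrl_step z (padded w ! i)" by blast
    then have "amp machine w r (Config (enc (z', p')) i' t' x') (Config (enc (z, p)) i t x) = 0"
    proof cases
      case 1
      then show ?thesis by (subst amp_def, subst if_not_P) auto
    next
      case 2
      then show ?thesis by (simp add: amp_def zero cong: if_cong)
    qed
    with False show ?thesis by auto
  qed
qed

text \<open>At a merge the two paths go to (1/2, 1/2, 1/sqrt 2) and (1/2, 1/2, -1/sqrt 2), which are
  orthonormal. \<open>Init\<close> overlaps with the running paths, hence the assumption; it occurs
  only at input position 0.\<close>

lemma coef_orthonormal:
  assumes "p = Init \<longleftrightarrow> p' = Init"
  shows "(\<Sum>r\<in>{0, 1}. \<Sum>q\<in>UNIV. cnj (coef z \<sigma> p q r) * coef z \<sigma> p' q r) = of_bool (p = p')"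
proof -
  have sq: "complex_of_real (sqrt 2) * complex_of_real (sqrt 2) = 2"
    by (simp flip: of_real_mult)
  show ?thesis
    using assms
    by (cases p; cases p') (auto simp: UNIV_path sq)
qed

definition binary :: "tape \<Rightarrow> bool" where
  "binary s \<longleftrightarrow> (\<forall>x. fst s x \<in> {Blank, WSym 0})"

lemma binary_act: "binary s \<Longrightarrow> binary (act z p \<sigma> s)"
  by (auto simp: binary_def act_def put_def flip_def)

text \<open>\<open>flip\<close> is an involution on \<open>Blank\<close> and \<open>WSym 0\<close>,
  which makes a toggle reversible on binary tapes.\<close>

lemma put_inj:
  assumes "binary s" "binary s'"
    and eq: "put b d s = put b d s'"
  shows "s = s'"
proof -
  have 1: "snd s = snd s'" using eq by (simp add: put_def)
  have 2: "fst s x = fst s' x" for x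
  proof (cases b)
    case True
    then have "((fst s)(snd s := flip (fst s (snd s)))) x = ((fst s')(snd s := flip (fst s' (snd s)))) x"
      using eq 1 by (simp add: put_def)
    then show ?thesis
      using assms(1)[unfolded binary_def, rule_format, of x] assms(2)[unfolded binary_def, rule_format, of x]
      by (cases "x = snd s") (auto simp: flip_def split: if_splits)
  qed (use eq in \<open>simp add: put_def\<close>)
  then have "fst s = fst s'" by auto
  with 1 show ?thesis by (simp add: prod_eq_iff)
qed

lemma put_Stay [simp]: "put False Stay s = s"
  by (simp add: put_def shift_def)

lemma act_trivial [simp]: "act z p LeftEnd s = s" "act z p RightEnd s = s" "act z Init \<sigma> s = s"
    "act z (Rej k) \<sigma> s = s"
  by (simp_all add: act_def)

text \<open>Path \<open>False\<close> is inactive here and path \<open>True\<close> never writes an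
  overflow digit, so tape and head rest while the paths interfere.\<close>

lemma act_merges: "merges k z \<sigma> \<Longrightarrow> act z (Run k x) \<sigma> s = s"
  by (cases z; cases x) (auto simp: merges_def act_def active_def)

section \<open>The deterministic run of one control and four tapes\<close>

definition init_state :: "ctrl \<times> (bool \<Rightarrow> bool \<Rightarrow> tape)" where
  "init_state = ((0, True, False), \<lambda>k x. (\<lambda>_. Blank, 0))"

text \<open>What the four paths do when each keeps its label. Equality of the compared tapes at
  every merge keeps this description valid for the quantum run.\<close>

definition step :: "ctrl \<times> (bool \<Rightarrow> bool \<Rightarrow> tape) \<Rightarrow> letter tsym \<Rightarrow> ctrl \<times> (bool \<Rightarrow> bool \<Rightarrow> tape)" where
  "step S \<sigma> = (ctrl_step (fst S) \<sigma>, \<lambda>k x. act (fst S) (Run k x) \<sigma> (snd S k x))"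

definition agree :: "ctrl \<times> (bool \<Rightarrow> bool \<Rightarrow> tape) \<Rightarrow> letter tsym \<Rightarrow> bool \<Rightarrow> bool" where
  "agree S \<sigma> k \<longleftrightarrow> (merges k (fst S) \<sigma> \<longrightarrow> snd S k False = snd S k True)"

subsection \<open>Blocks and their successors\<close>

definition all_along :: "('a \<Rightarrow> letter tsym \<Rightarrow> bool) \<Rightarrow> ('a \<Rightarrow> letter tsym \<Rightarrow> 'a) \<Rightarrow> 'a \<Rightarrow> letter tsym list \<Rightarrow> bool" where
  "all_along P f S u \<longleftrightarrow> (\<forall>i<length u. P (foldl f S (take i u)) (u ! i))"

lemma all_along_Nil [simp]: "all_along P f S []"
  by (simp add: all_along_def)

lemma all_along_Cons [simp]: "all_along P f S (\<sigma> # u) \<longleftrightarrow> P S \<sigma> \<and> all_along P f (f S \<sigma>) u"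
  by (simp add: all_along_def All_less_Suc2)

lemma all_along_append [simp]:
  "all_along P f S (u @ v) \<longleftrightarrow> all_along P f S u \<and> all_along P f (foldl f S u) v"
  by (induction u arbitrary: S) auto

definition dig :: "bool \<Rightarrow> letter" where
  "dig b = (if b then L1 else L0)"

abbreviation bits :: "bool list \<Rightarrow> letter tsym list" where
  "bits y \<equiv> map (\<lambda>b. Sym (dig b)) y"

definition write_bits :: "dir \<Rightarrow> bool list \<Rightarrow> tape \<Rightarrow> tape" where
  "write_bits d y s = foldl (\<lambda>s b. put b d s) s y"

lemma write_bits_simps [simp]: "write_bits d [] s = s" "write_bits d (b # y) s = write_bits d y (put b d s)"
    "write_bits d (y @ y') s = write_bits d y' (write_bits d y s)"
  by (simp_all add: write_bits_def)

lemma snd_put [simp]: "snd (put b d s) = snd s + shift d"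
  by (simp add: put_def)

lemma snd_write_bits: "snd (write_bits d y s) = snd s + shift d * int (length y)"
  by (induction y arbitrary: s) (auto simp: algebra_simps)

lemma fst_write_bits_behind:
  "d \<noteq> Stay \<Longrightarrow> (x - snd s) * shift d < 0 \<Longrightarrow> fst (write_bits d y s) x = fst s x"
proof (induction y arbitrary: s)
  case (Cons b y)
  then have "(x - snd (put b d s)) * shift d < 0"
    by (cases d) (auto simp: shift_def)
  moreover have "fst (put b d s) x = fst s x"
    using Cons.prems by (auto simp: put_def)
  ultimately show ?case using Cons by simp
qed simp

lemma flip_neq: "flip g \<noteq> g"
  by (simp add: flip_def)

text \<open>The displacement of the head gives the length. The first square is left behind for good,
  and it is flipped iff the first digit is set. The old contents of \<open>s\<close> are arbitrary,
  so that all pairs can share the same squares.\<close>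

lemma write_bits_inj:
  assumes "d \<noteq> Stay" "write_bits d u s = write_bits d v s"
  shows "u = v"
proof -
  have "length u = length v"
    using arg_cong[OF assms(2), of snd] assms(1) by (cases d) (auto simp: snd_write_bits shift_def)
  then show ?thesis using assms(2)
  proof (induction u v arbitrary: s rule: list_induct2)
    case (Cons b u c v)
    have square: "fst (write_bits d y (put e d s)) (snd s) = (if e then flip (fst s (snd s)) else fst s (snd s))"
      for e y
    proof -
      have "(snd s - snd (put e d s)) * shift d < 0"
        using assms(1) by (cases d) (auto simp: shift_def)
      then show ?thesis
        using assms(1) by (simp add: fst_write_bits_behind) (simp add: put_def)
    qed
    have "b = c"
      using Cons.prems square[of u b] square[of v c] flip_neq[of "fst s (snd s)"]
      by (auto split: if_splits)
    with Cons show ?case by auto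
  qed simp
qed

fun add_carry :: "bool \<Rightarrow> bool list \<Rightarrow> bool list" where
  "add_carry c [] = []"
| "add_carry c (b # y) = (b \<noteq> c) # add_carry (b \<and> c) y"

lemma length_add_carry [simp]: "length (add_carry c y) = length y"
  by (induction c y rule: add_carry.induct) auto

lemma add_carry_False [simp]: "add_carry False y = y"
  by (induction y) auto

text \<open>The carry survives iff all digits are 1; the overflow digit is then written at the
  separator. For \<open>j = 0\<close> this turns the empty word into the word 0.\<close>

definition next_word :: "nat \<Rightarrow> bool list \<Rightarrow> bool list" where
  "next_word j y = add_carry True y @ (if \<forall>b\<in>set y. b then [j \<noteq> 0] else [])"

abbreviation block :: "bool list \<Rightarrow> letter tsym list" where
  "block y \<equiv> bits y @ [Sym LA]"

lemma foldl_bits: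
  "foldl step ((j, c, l), S) (bits y) =
    ((j, c \<and> (\<forall>b\<in>set y. b), l \<and> y = []),
     \<lambda>k x. if active k x j then write_bits (dirn k j) (if x then y else add_carry c y) (S k x) else S k x)"
proof (induction y arbitrary: c l S)
  case Nil
  then show ?case by (simp add: fun_eq_iff)
next
  case (Cons b y)
  have "step ((j, c, l), S) (Sym (dig b)) = ((j, c \<and> b, False),
     \<lambda>k x. if active k x j then put (if x then b else b \<noteq> c) (dirn k j) (S k x) else S k x)"
    by (cases b) (auto simp: step_def dig_def act_def put_def shift_def fun_eq_iff)
  then show ?case
    by (auto simp: Cons.IH fun_eq_iff conj_commute)
qed

lemma foldl_block:
  "foldl step ((j, True, l), S) (block y) = ((next_block j, True, True),
     \<lambda>k x. if active k x j then write_bits (dirn k j) (if x then y else next_word j y) (S k x) else S k x)"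
  by (auto simp: foldl_bits step_def act_def fun_eq_iff next_word_def put_def shift_def)

section \<open>Comparisons determine the blocks\<close>

definition agree_all :: "ctrl \<times> (bool \<Rightarrow> bool \<Rightarrow> tape) \<Rightarrow> letter tsym \<Rightarrow> bool" where
  "agree_all S \<sigma> \<longleftrightarrow> (\<forall>k. agree S \<sigma> k)"

lemma all_along_agree_no_sep: "Sym LA \<notin> set u \<Longrightarrow> all_along agree_all step S u"
  by (auto simp: all_along_def agree_all_def agree_def merges_def in_set_conv_nth)

lemma sep_notin_bits [simp]: "Sym LA \<notin> set (bits y)"
  by (auto simp: dig_def split: if_splits)

text \<open>Tapes are compared only at the separator, in the check whose path \<open>True\<close>
  has just written \<open>y\<close>; path \<open>False\<close> of that check is idle during this
  block.\<close>

lemma all_along_agree_block: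
  "all_along agree_all step ((j, True, l), S) (block y) \<longleftrightarrow>
    (\<forall>k. active k True j \<longrightarrow> S k False = write_bits (dirn k j) y (S k True))"
proof -
  have "active k True j \<Longrightarrow> \<not> active k False j" for k
    by (auto simp: active_def)
  then show ?thesis
    using all_along_agree_no_sep[OF sep_notin_bits, of "((j, True, l), S)" y]
    by (auto simp: foldl_bits agree_all_def agree_def merges_def)
qed

text \<open>Invariant at the beginning of block \<open>j\<close>, where \<open>u\<close> is the word that the block should be.\<close>

definition in_step :: "nat \<Rightarrow> bool list \<Rightarrow> (bool \<Rightarrow> bool \<Rightarrow> tape) \<Rightarrow> bool" where
  "in_step j u S \<longleftrightarrow>
    (\<forall>k. S k False = (if active k True j then write_bits (dirn k j) u (S k True) else S k True))"

lemma dirn_neq_Stay [simp]: "dirn k j \<noteq> Stay"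
  by (simp add: dirn_def)

lemma even_next_block [simp]: "even (next_block j) = odd j"
  by (auto simp: next_block_def)

lemma next_block_mod_4: "next_block j mod 4 = Suc j mod 4"
proof (cases "j < 6")
  case False
  then have "next_block j mod 4 = (j - 3) mod 4" by (simp add: next_block_def)
  also have "\<dots> = (j - 3 + 4) mod 4" by simp
  also have "j - 3 + 4 = Suc j" using False by simp
  finally show ?thesis .
qed (simp add: next_block_def)

lemma even_half_iff: "even (n div 2) \<longleftrightarrow> n mod 4 < (2::nat)"
  by presburger

text \<open>\<open>dirn\<close> depends on \<open>j\<close>, shifted by 0 or 1, modulo 4, where
  \<open>next_block\<close> acts like \<open>Suc\<close>. So both blocks of a pair share a direction
  and the next pair reverses it.\<close>

lemma dirn_next_block:
  "active k False j \<Longrightarrow> dirn k (next_block j) = dirn k j"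
  "shift (dirn k (next_block (next_block j))) = - shift (dirn k j)"
proof -
  have 1: "next_block j mod 4 = Suc j mod 4" for j by (rule next_block_mod_4)
  have e: "even ((next_block j + a) div 2) = even ((Suc j + a) div 2)" for j a
    unfolding even_half_iff using 1[of j] by (metis mod_add_cong)
  show "active k False j \<Longrightarrow> dirn k (next_block j) = dirn k j"
    using e[of j 0] e[of j 1] by (cases k) (auto simp: dirn_def active_def)
  have "even ((next_block (next_block j) + a) div 2) = even ((Suc (Suc j) + a) div 2)" for a
    unfolding e using e[of j "Suc a"] by simp
  then show "shift (dirn k (next_block (next_block j))) = - shift (dirn k j)"
    unfolding dirn_def by (simp add: shift_def)
qed

text \<open>While \<open>u\<close> is read, path \<open>False\<close> of one check writes the
  successor ahead of its partner, and path \<open>True\<close> of the other check catches up with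
  its partner. The next block swaps the roles of the checks.\<close>

lemma in_step_block:
  assumes "in_step j u S"
  shows "in_step (next_block j) (next_word j u)
    (\<lambda>k x. if active k x j then write_bits (dirn k j) (if x then u else next_word j u) (S k x) else S k x)"
  unfolding in_step_def
proof
  fix k
  have act: "active k True (next_block j) = active k False j" "active k True j = (\<not> active k False j)"
    by (auto simp: active_def)
  show "(if active k False j then write_bits (dirn k j) (if False then u else next_word j u) (S k False) else S k False) =
    (if active k True (next_block j) then write_bits (dirn k (next_block j)) (next_word j u)
      (if active k True j then write_bits (dirn k j) (if True then u else next_word j u) (S k True) else S k True)
     else if active k True j then write_bits (dirn k j) (if True then u else next_word j u) (S k True) else S k True)"
    using assms[unfolded in_step_def, rule_format, of k] dirn_next_block(1)[of k j]
    by (cases "active k False j") (simp_all add: act)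
qed

fun expected :: "nat \<Rightarrow> bool list \<Rightarrow> nat \<Rightarrow> bool list list" where
  "expected j u 0 = []"
| "expected j u (Suc n) = u # expected (next_block j) (next_word j u) n"

lemma length_expected [simp]: "length (expected j u n) = n"
  by (induction n arbitrary: j u) auto

text \<open>Exactly one check compares each block with the word prepared for it, and injectivity of
  \<open>write_bits\<close> lets only that word pass. The rest \<open>v\<close> has no separator and
  hence no comparison.\<close>

lemma all_along_agree_iff:
  assumes "in_step j u S" "Sym LA \<notin> set v"
  shows "all_along agree_all step ((j, True, l), S) (concat (map block ys) @ v)
    \<longleftrightarrow> ys = expected j u (length ys)"
  using assms(1)
proof (induction ys arbitrary: j u S l)
  case Nil
  then show ?case by (simp add: all_along_agree_no_sep[OF assms(2)])
next
  case (Cons y ys)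
  \<comment> \<open>The check that compares at the end of block \<open>j\<close>.\<close>
  define k where "k = odd j"
  have k: "active k True j" by (simp add: k_def active_def)
  have first: "all_along agree_all step ((j, True, l), S) (block y) \<longleftrightarrow> y = u"
  proof
    assume "all_along agree_all step ((j, True, l), S) (block y)"
    then have "write_bits (dirn k j) u (S k True) = write_bits (dirn k j) y (S k True)"
      using k Cons.prems by (auto simp: all_along_agree_block in_step_def simp del: all_along_append)
    then show "y = u" using write_bits_inj dirn_neq_Stay by metis
  next
    assume "y = u"
    then show "all_along agree_all step ((j, True, l), S) (block y)"
      using Cons.prems by (auto simp: all_along_agree_block in_step_def simp del: all_along_append)
  qed
  have "all_along agree_all step ((j, True, l), S) (concat (map block (y # ys)) @ v) \<longleftrightarrow>
    all_along agree_all step ((j, True, l), S) (block y) \<and>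
    all_along agree_all step (foldl step ((j, True, l), S) (block y)) (concat (map block ys) @ v)"
    by (simp only: concat.simps list.map append_assoc[of "block y"] all_along_append[of _ _ _ "block y"])
  also have "\<dots> \<longleftrightarrow> y = u \<and> ys = expected (next_block j) (next_word j u) (length ys)"
    unfolding first foldl_block using Cons.IH[OF in_step_block[OF Cons.prems]] by auto
  finally show ?case by simp
qed

lemma in_step_init: "in_step 0 [] (snd init_state)"
  by (simp add: in_step_def init_state_def)

section \<open>Incrementing reversed binary representations\<close>

definition incr :: "bool list \<Rightarrow> bool list" where
  "incr = next_word 1"

lemma next_word_pos: "0 < j \<Longrightarrow> next_word j = incr"
  by (simp add: fun_eq_iff incr_def next_word_def)

lemma next_block_pos [simp]: "0 < next_block j"
  by (simp add: next_block_def)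

lemma expected_pos: "0 < j \<Longrightarrow> expected j u n = map (\<lambda>i. (incr ^^ i) u) [0..<n]"
proof (induction n arbitrary: j u)
  case (Suc n)
  then show ?case
    by (simp add: next_word_pos upt_conv_Cons map_Suc_upt[symmetric] comp_def funpow_swap1 del: upt_Suc)
qed simp

lemma expected_0: "expected 0 [] (Suc n) = [] # map (\<lambda>i. (incr ^^ i) [False]) [0..<n]"
  by (simp add: expected_pos next_word_def)

text \<open>With the least significant digit first, incrementing an even number changes only the
  head of its list, while an odd number passes the carry on to \<open>n div 2\<close>; hence strong
  induction.\<close>

lemma rev_bin_eq_incr: "rev (bin n) = map dig ((incr ^^ n) [False])"
proof -
  define rb where "rb n = map (\<lambda>l. l = L1) (rev (bin n))" for n
  have rb: "rb n = (if n < 2 then [odd n] else odd n # rb (n div 2))" for n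
    unfolding rb_def by (subst bin.simps) (auto simp: digit_def odd_iff_mod_2_eq_one)
  have incr: "incr (rb n) = rb (Suc n)" for n
  proof (induction n rule: less_induct)
    case (less n)
    consider "n = 0" | "n = 1" | "2 \<le> n" "even n" | "2 \<le> n" "odd n" by linarith
    then show ?case
    proof cases
      case 4
      then have "incr (rb (n div 2)) = rb (Suc (n div 2))" by (intro less) simp
      moreover have "rb n = True # rb (n div 2)" "rb (Suc n) = False # rb (Suc (n div 2))"
        using 4 by (simp_all add: rb[of n] rb[of "Suc n"])
      ultimately show ?thesis by (simp add: incr_def next_word_def)
    next
      case 3
      then have "rb n = False # rb (n div 2)" "rb (Suc n) = True # rb (n div 2)"
        by (simp_all add: rb[of n] rb[of "Suc n"])
      then show ?thesis by (simp add: incr_def next_word_def)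
    qed (simp_all add: rb[of 0] rb[of "Suc 0"] rb[of 2] rb[of "Suc (Suc 0)"] incr_def next_word_def)
  qed
  have "(incr ^^ n) [False] = rb n"
    by (induction n) (simp add: rb[of 0], simp add: incr)
  moreover have "set (bin n) \<subseteq> {L0, L1}"
  proof (induction n rule: less_induct)
    case (less n)
    show ?case
    proof (cases "n < 2")
      case False
      then have "set (bin (n div 2)) \<subseteq> {L0, L1}" by (intro less) simp
      then show ?thesis by (subst bin.simps) (simp add: digit_def)
    qed (simp add: bin.simps[of n] digit_def)
  qed
  then have "map dig (rb n) = rev (bin n)"
    unfolding rb_def map_map by (intro map_idI) (auto simp: dig_def)
  ultimately show ?thesis by simp
qed

section \<open>Inputs cut into blocks, and the language in this form\<close>

definition word_of :: "bool list list \<Rightarrow> bool list \<Rightarrow> letter list" where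
  "word_of ys r = concat (map (\<lambda>y. map dig y @ [LA]) ys) @ map dig r"

lemma word_of_cases: obtains ys r where "w = word_of ys r"
proof -
  have "\<exists>ys r. w = word_of ys r"
  proof (induction w)
    case Nil
    show ?case by (intro exI[of _ "[]"]) (simp add: word_of_def)
  next
    case (Cons a w)
    then obtain ys r where w: "w = word_of ys r" by blast
    show ?case
    proof (cases "a = LA")
      case True
      then have "a # w = word_of ([] # ys) r" by (simp add: w word_of_def)
      then show ?thesis by blast
    next
      case False
      then obtain b where a: "a = dig b" by (cases a) (auto simp: dig_def intro: that[of True] that[of False])
      show ?thesis
      proof (cases ys)
        case Nil
        then have "a # w = word_of [] (b # r)" by (simp add: w word_of_def a)
        then show ?thesis by blast
      next
        case (Cons y ys')
        then have "a # w = word_of ((b # y) # ys') r" by (simp add: w word_of_def a)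
        then show ?thesis by blast
      qed
    qed
  qed
  then show ?thesis using that by blast
qed

text \<open>The leading \<open>LA\<close> closes an empty block 0, so the numbers 0 to k yield k + 2
  blocks, and \<open>k \<ge> 1\<close> becomes \<open>3 \<le> n\<close>.\<close>

lemma L_rev_bins_eq:
  "L_rev_bins = {word_of (expected 0 [] n) [] | n. 3 \<le> n}"
proof -
  have shift_sep: "concat (map (\<lambda>i. LA # f i) xs) @ [LA] = LA # concat (map (\<lambda>i. f i @ [LA]) xs)"
    for f :: "nat \<Rightarrow> letter list" and xs
    by (induction xs) auto
  have "concat (map (\<lambda>i. LA # rev (bin i)) [0..<Suc k]) @ [LA] = word_of (expected 0 [] (Suc (Suc k))) []" for k
    unfolding shift_sep expected_0 by (simp add: word_of_def rev_bin_eq_incr comp_def del: upt_Suc)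
  then have "L_rev_bins = {word_of (expected 0 [] (Suc (Suc k))) [] | k. 1 \<le> k}"
    by (simp add: L_rev_bins_def del: upt_Suc expected.simps)
  also have "\<dots> = {word_of (expected 0 [] n) [] | n. 3 \<le> n}"
  proof (intro Collect_cong iffI; elim exE conjE)
    fix w n assume "w = word_of (expected 0 [] n) []" and "(3::nat) \<le> n"
    then obtain k where "n = Suc (Suc k)" "1 \<le> k"
      by (cases n; cases "n - 1") auto
    with \<open>w = _\<close> show "\<exists>k. w = word_of (expected 0 [] (Suc (Suc k))) [] \<and> 1 \<le> k" by blast
  next
    fix w k assume "w = word_of (expected 0 [] (Suc (Suc k))) []" "(1::nat) \<le> k"
    then show "\<exists>n. w = word_of (expected 0 [] n) [] \<and> 3 \<le> n"
      by (intro exI[of _ "Suc (Suc k)"]) auto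
  qed
  finally show ?thesis .
qed

lemma padded_word_of:
  "padded (word_of ys r) = LeftEnd # concat (map block ys) @ (bits r @ [RightEnd])"
  by (simp add: padded_def word_of_def map_concat comp_def)

lemma step_ends [simp]: "step S LeftEnd = S" "step S RightEnd = S"
  by (simp_all add: step_def act_def put_def shift_def)

lemma agree_all_ends [simp]: "agree_all S LeftEnd"
  by (simp add: agree_all_def agree_def merges_def)

lemma agree_all_padded:
  "all_along agree_all step init_state (padded (word_of ys r)) \<longleftrightarrow> ys = expected 0 [] (length ys)"
proof -
  have init: "init_state = ((0, True, False), snd init_state)" by (simp add: init_state_def)
  have "Sym LA \<notin> set (bits r @ [RightEnd])" by (auto simp: dig_def split: if_splits)
  from all_along_agree_iff[OF in_step_init this, of False ys] show ?thesis
    unfolding padded_word_of all_along_Cons by (simp add: init[symmetric] del: all_along_append)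
qed

lemma fst_foldl_blocks:
  "fst (foldl step ((j, True, l), S) (concat (map block ys))) =
    ((next_block ^^ length ys) j, True, l \<or> ys \<noteq> [])"
proof (induction ys arbitrary: j l S)
  case (Cons y ys)
  have "foldl step ((j, True, l), S) (concat (map block (y # ys))) =
    foldl step (foldl step ((j, True, l), S) (block y)) (concat (map block ys))"
    by (simp only: concat.simps list.map foldl_append)
  then show ?case by (simp add: foldl_block Cons.IH funpow_swap1 del: foldl_append)
qed simp

definition ctrl_accepts :: "ctrl \<Rightarrow> bool" where
  "ctrl_accepts z \<longleftrightarrow> 3 \<le> fst z \<and> snd (snd z)"

text \<open>The cycle 3, 4, 5, 6 is entered after three separators and never left.\<close>

lemma next_block_funpow_ge: "3 \<le> (next_block ^^ n) 0 \<longleftrightarrow> 3 \<le> n"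
proof -
  have ge: "3 \<le> j \<Longrightarrow> 3 \<le> next_block j" for j
    by (cases "j < 6") (simp_all add: next_block_def)
  have "3 \<le> (next_block ^^ n) 0" if "3 \<le> n"
    using that
  proof (induction n rule: dec_induct)
    case base
    show ?case by (simp add: next_block_def numeral_3_eq_3)
  next
    case (step n)
    then show ?case using ge by simp
  qed
  moreover have "(next_block ^^ n) 0 < 3" if "n < 3"
  proof -
    from that consider "n = 0" | "n = 1" | "n = Suc 1" by linarith
    then show ?thesis by cases (simp_all add: next_block_def)
  qed
  ultimately show ?thesis by (meson not_le)
qed

lemma ctrl_final:
  "ctrl_accepts (fst (foldl step init_state (padded (word_of ys r)))) \<longleftrightarrow> 3 \<le> length ys \<and> r = []"
proof -
  obtain S where S: "foldl step ((0, True, False), snd init_state) (concat (map block ys)) =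
      (((next_block ^^ length ys) 0, True, ys \<noteq> []), S)"
    using fst_foldl_blocks[of 0 False "snd init_state" ys] by (metis prod.collapse)
  have init: "init_state = ((0, True, False), snd init_state)" by (simp add: init_state_def)
  show ?thesis
    unfolding padded_word_of foldl_Cons foldl_append step_ends
    by (subst init, subst S) (auto simp: ctrl_accepts_def foldl_bits next_block_funpow_ge step_def)
qed

subsection \<open>The range of the head\<close>

definition near :: "nat \<Rightarrow> ctrl \<times> (bool \<Rightarrow> bool \<Rightarrow> tape) \<Rightarrow> letter tsym \<Rightarrow> bool" where
  "near B S \<sigma> \<longleftrightarrow> (\<forall>k x. \<bar>snd (snd S k x)\<bar> \<le> int B)"

text \<open>The next pair is written towards the origin, so that the head ends up at most its length
  beyond it.\<close>

definition zigzag :: "nat \<Rightarrow> bool list \<Rightarrow> (bool \<Rightarrow> bool \<Rightarrow> tape) \<Rightarrow> bool" where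
  "zigzag j u S \<longleftrightarrow> (\<forall>k x.
    - int (length u) \<le> shift (dirn k (if active k x j then j else next_block j)) * snd (S k x) \<and>
    shift (dirn k (if active k x j then j else next_block j)) * snd (S k x) \<le> 0)"

lemma length_next_word: "length u \<le> length (next_word j u)"
  by (simp add: next_word_def)

lemma shift_dirn: "shift (dirn k j) = 1 \<or> shift (dirn k j) = -1"
  by (simp add: dirn_def shift_def)

text \<open>The head starts at most \<open>length u\<close> squares before the origin and an active
  path writes at least that many digits, so it reaches the origin. Seen in the reversed direction of
  the next pair it is again behind the origin, by at most the length just written.\<close>

lemma zigzag_block:
  assumes "zigzag j u S"
  shows "zigzag (next_block j) (next_word j u)
    (\<lambda>k x. if active k x j then write_bits (dirn k j) (if x then u else next_word j u) (S k x) else S k x)"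
  unfolding zigzag_def
proof (intro allI)
  fix k x
  have act: "active k x (next_block j) = (\<not> active k x j)" by (auto simp: active_def)
  have len: "length u \<le> length (next_word j u)" by (rule length_next_word)
  note z = assms[unfolded zigzag_def, rule_format, of k x]
  let ?q = "snd (if active k x j then write_bits (dirn k j) (if x then u else next_word j u) (S k x) else S k x)"
  let ?d = "shift (dirn k (if active k x (next_block j) then next_block j else next_block (next_block j)))"
  show "- int (length (next_word j u)) \<le> ?d * ?q \<and> ?d * ?q \<le> 0"
  proof (cases "active k x j")
    case True
    then show ?thesis
      using z len shift_dirn[of k j] by (auto simp: act dirn_next_block snd_write_bits algebra_simps)
  next
    case False
    then show ?thesis using z len by (auto simp: act)
  qed
qed

lemma near_block:
  assumes "zigzag j u S" "length u \<le> B"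
  shows "all_along (near B) step ((j, True, l), S) (block u)"
  unfolding all_along_def
proof (intro allI impI)
  fix i assume "i < length (block u)"
  then have i: "i \<le> length u" by simp
  then have take: "take i (block u) = bits (take i u)" by (simp add: take_map)
  show "near B (foldl step ((j, True, l), S) (take i (block u))) (block u ! i)"
    unfolding take foldl_bits near_def
  proof (intro allI)
    fix k x
    show "\<bar>snd (snd ((j, True \<and> (\<forall>b\<in>set (take i u). b), l \<and> take i u = []),
        \<lambda>k x. if active k x j then write_bits (dirn k j) (if x then take i u else add_carry True (take i u)) (S k x)
          else S k x) k x)\<bar> \<le> int B"
      using assms(1)[unfolded zigzag_def, rule_format, of k x] assms(2) i
        shift_dirn[of k j] shift_dirn[of k "next_block j"]
      by (auto simp: snd_write_bits split: if_splits)
  qed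
qed

text \<open>The bound includes one word more than the blocks read, since path \<open>False\<close>
  has already written the successor of the last block.\<close>

lemma near_blocks:
  assumes "zigzag j u S" "\<forall>v\<in>set (expected j u (Suc n)). length v \<le> B"
  shows "all_along (near B) step ((j, True, l), S) (concat (map block (expected j u n)) @ [RightEnd])"
  using assms
proof (induction n arbitrary: j u S l)
  case 0
  show ?case
    unfolding expected.simps list.map concat.simps append_Nil all_along_Cons near_def
  proof (intro conjI allI all_along_Nil)
    fix k x
    show "\<bar>snd (snd ((j, True, l), S) k x)\<bar> \<le> int B"
      using 0(1)[unfolded zigzag_def, rule_format, of k x] 0(2)
        shift_dirn[of k j] shift_dirn[of k "next_block j"]
      by (auto split: if_splits)
  qed
next
  case (Suc n)
  have "all_along (near B) step (foldl step ((j, True, l), S) (block u))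
      (concat (map block (expected (next_block j) (next_word j u) n)) @ [RightEnd])"
    unfolding foldl_block using Suc.prems by (intro Suc.IH zigzag_block) auto
  moreover have "all_along (near B) step ((j, True, l), S) (block u)"
    using Suc.prems by (intro near_block) auto
  ultimately show ?case
    by (simp only: expected.simps list.map concat.simps append_assoc[of "block u"] all_along_append[of _ _ _ "block u"])
qed

lemma near_padded:
  assumes "\<forall>v\<in>set (expected 0 [] (Suc n)). length v \<le> B"
  shows "all_along (near B) step init_state (padded (word_of (expected 0 [] n) []))"
proof -
  have init: "init_state = ((0, True, False), snd init_state)" by (simp add: init_state_def)
  have "zigzag 0 [] (snd init_state)" by (simp add: zigzag_def init_state_def)
  from near_blocks[OF this assms, of False] show ?thesis
    unfolding padded_word_of all_along_Cons step_ends init[symmetric]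
    by (simp add: near_def init_state_def del: all_along_append)
qed

section \<open>Logarithmic length of the blocks\<close>

lemma length_bin: "2 ^ (length (bin n) - 1) \<le> max 1 n"
proof (induction n rule: less_induct)
  case (less n)
  show ?case
  proof (cases "n < 2")
    case True
    then show ?thesis by (simp add: bin.simps[of n])
  next
    case False
    then have "2 ^ (length (bin (n div 2)) - 1) \<le> n div 2" using less[of "n div 2"] by (auto simp: max_def split: if_splits)
    moreover have "length (bin (n div 2)) > 0" by (subst bin.simps) simp
    moreover have "length (bin n) = Suc (length (bin (n div 2)))" using False by (subst bin.simps) simp
    ultimately show ?thesis
      by (cases "length (bin (n div 2))") auto
  qed
qed

lemma length_of_expected_word:
  assumes "v \<in> set (expected 0 [] (Suc n))" "1 \<le> n"
  shows "2 ^ (length v - 1) \<le> n"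
proof -
  from assms(1) consider "v = []" | i where "i < n" "v = (incr ^^ i) [False]"
    unfolding expected_0 by auto
  then show ?thesis
  proof cases
    case 2
    then have "length v = length (bin i)"
      using rev_bin_eq_incr[of i] by (metis length_map length_rev)
    then show ?thesis using length_bin[of i] 2 by (auto simp: max_def split: if_splits)
  qed (use assms in simp)
qed

lemma length_word_of: "length ys \<le> length (word_of ys r)"
  by (induction ys) (auto simp: word_of_def)

subsection \<open>Quantum evolution\<close>

context
  fixes w :: "letter list"
begin

abbreviation W where "W \<equiv> padded w"
abbreviation N where "N \<equiv> length (padded w)"
abbreviation Att where "Att \<equiv> attainable machine w"

definition run :: "nat \<Rightarrow> ctrl \<times> (bool \<Rightarrow> bool \<Rightarrow> tape)" where
  "run i = foldl step init_state (take i W)"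

definition Z where "Z i = fst (run i)"
definition \<tau> where "\<tau> k x i = snd (run i) k x"

lemma run_Suc: "i < N \<Longrightarrow> run (Suc i) = step (run i) (W ! i)"
  by (simp add: run_def take_Suc_conv_app_nth)

lemma Z_Suc: "i < N \<Longrightarrow> Z (Suc i) = ctrl_step (Z i) (W ! i)"
  by (simp add: Z_def run_Suc step_def)

lemma tau_Suc: "i < N \<Longrightarrow> \<tau> k x (Suc i) = act (Z i) (Run k x) (W ! i) (\<tau> k x i)"
  by (simp add: Z_def \<tau>_def run_Suc step_def)

lemma Z_0: "Z 0 = (0, True, False)" and tau_0: "\<tau> k x 0 = (\<lambda>_. Blank, 0)"
  by (simp_all add: Z_def \<tau>_def run_def init_state_def)

lemma Z_in [simp]: "i \<le> N \<Longrightarrow> Z i \<in> ctrls"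
  by (induction i) (auto simp: Z_0 Z_Suc ctrls_def[of] intro: ctrl_step_in[unfolded ctrls_def])

lemma W_0: "W ! 0 = LeftEnd" and N_pos: "0 < N"
  by (simp_all add: padded_def)

text \<open>The control is a function of the input position, so position, path and tape are
  coordinates of a configuration.\<close>

definition cfg :: "nat \<Rightarrow> path \<Rightarrow> tape \<Rightarrow> (nat, nat) config" where
  "cfg i p s = Config (enc (Z i, p)) i (fst s) (snd s)"

lemma cfg_eq_iff [simp]: "cfg i p s = cfg i' p' s' \<longleftrightarrow> i = i' \<and> p = p' \<and> s = s'"
  by (auto simp: cfg_def prod_eq_iff)

lemma input_pos_cfg [simp]: "input_pos (cfg i p s) = i"
  by (simp add: cfg_def)

definition pth :: "(nat, nat) config \<Rightarrow> path" where
  "pth c = snd (dec (cstate c))"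

lemma pth_cfg [simp]: "pth (cfg i p s) = p"
  by (simp add: pth_def cfg_def)

lemma amp_cfg:
  assumes "binary s" "i \<le> N"
  shows "amp machine w r (cfg i' p' s') (cfg i p s) =
    (if i < N \<and> i' = Suc i \<and> s' = act (Z i) p (W ! i) s then coef (Z i) (W ! i) p p' r else 0)"
  using assms unfolding cfg_def binary_def
  by (subst amp_machine) (auto simp: Z_Suc)

lemma initial_config_cfg: "initial_config machine = cfg 0 Init (\<lambda>_. Blank, 0)"
  by (simp add: initial_config_def cfg_def Z_0)

lemma one_step_cfg:
  assumes "one_step machine w (cfg i p s) c'" "binary s"
  obtains p' r where "c' = cfg (Suc i) p' (act (Z i) p (W ! i) s)" "coef (Z i) (W ! i) p p' r \<noteq> 0"
    "i < N"
proof -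
  have i: "i < N" using one_step_cases(1)[OF assms(1)] by simp
  obtain q' g d where c': "c' = Config q' (Suc i) (wom_write (wom_tape (cfg i p s)) (wom_pos (cfg i p s)) g)
      (wom_pos (cfg i p s) + shift d)" and q': "q' \<in> states machine"
    using one_step_cases(3)[OF assms(1)] by auto
  from q' obtain z' p' where q: "q' = enc (z', p')" by auto
  obtain t x where s: "s = (t, x)" by fastforce
  obtain t' x' where c'2: "c' = Config (enc (z', p')) (Suc i) t' x'" using c' q by simp
  obtain r where "amp machine w r c' (cfg i p s) \<noteq> 0"
    using assms(1) by (auto simp: one_step_def)
  then have "z' = Z (Suc i) \<and> (t', x') = act (Z i) p (W ! i) s \<and> coef (Z i) (W ! i) p p' r \<noteq> 0"
    using assms(2) i unfolding c'2 cfg_def s binary_def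
    by (subst (asm) amp_machine) (auto simp: Z_Suc split: if_splits)
  then show ?thesis
    using that i c'2 by (metis cfg_def fst_conv snd_conv)
qed

text \<open>No transition enters \<open>Init\<close>, so it marks position 0, and every action
  preserves binary tapes.\<close>

lemma attainable_cfg:
  assumes "c \<in> Att"
  obtains i p s where "c = cfg i p s" "i \<le> N" "binary s" "i = 0 \<longleftrightarrow> p = Init"
    "i = 0 \<longrightarrow> s = (\<lambda>_. Blank, 0)"
proof -
  have "(one_step machine w)\<^sup>*\<^sup>* (initial_config machine) c"
    using assms by (simp add: attainable_def)
  then have "\<exists>i p s. c = cfg i p s \<and> i \<le> N \<and> binary s \<and> (i = 0 \<longleftrightarrow> p = Init) \<and>
    (i = 0 \<longrightarrow> s = (\<lambda>_. Blank, 0))"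
  proof (induction rule: rtranclp_induct)
    case base
    then show ?case
      unfolding initial_config_cfg by (intro exI) (auto simp: binary_def)
  next
    case (step b c)
    then obtain i p s where b: "b = cfg i p s" "i \<le> N" "binary s" "i = 0 \<longleftrightarrow> p = Init"
      by blast
    obtain p' r where c: "c = cfg (Suc i) p' (act (Z i) p (W ! i) s)"
      "coef (Z i) (W ! i) p p' r \<noteq> 0" "i < N"
      using one_step_cfg step.hyps(2) b(1,3) by metis
    have "p' \<noteq> Init"
      using c(2) by (cases p) auto
    then show ?case
      using c b(3) by (intro exI[of _ "Suc i"] exI) (auto intro: binary_act)
  qed
  then show ?thesis using that by blast
qed

lemma finite_Att [simp, intro]: "finite Att"
  by (rule finite_attainable) (auto simp: ctrls_def)

lemma attainable_step: "c \<in> Att \<Longrightarrow> amp machine w r c' c \<noteq> 0 \<Longrightarrow> r \<in> {0, 1} \<Longrightarrow> c' \<in> Att"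
  by (auto simp: attainable_def one_step_def intro: rtranclp.rtrancl_into_rtrancl)

lemma initial_attainable: "initial_config machine \<in> Att"
  by (simp add: attainable_def)

text \<open>All images of \<open>c\<close> carry one tape \<open>u\<close> and differ only in the
  path. Columns with different image tapes or positions have disjoint supports; otherwise the inner
  product is the one in \<open>coef_orthonormal\<close>.\<close>

lemma well_formed_word:
  assumes c: "c \<in> Att" "input_pos c < N" and c': "c' \<in> Att" "input_pos c' < N"
  shows "(\<Sum>r\<in>{0, 1}. \<Sum>b\<in>Att. cnj (amp machine w r b c) * amp machine w r b c')
    = (if c = c' then 1 else 0)"
proof -
  obtain i p s where eq: "c = cfg i p s" "i \<le> N" "binary s" "i = 0 \<longleftrightarrow> p = Init"
    "i = 0 \<longrightarrow> s = (\<lambda>_. Blank, 0)"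
    using attainable_cfg c(1) by metis
  obtain i' p' s' where eq': "c' = cfg i' p' s'" "i' \<le> N" "binary s'" "i' = 0 \<longleftrightarrow> p' = Init"
    "i' = 0 \<longrightarrow> s' = (\<lambda>_. Blank, 0)"
    using attainable_cfg c'(1) by metis
  define u where "u = act (Z i) p (W ! i) s"
  have i: "i < N" "i' < N" using c c' eq eq' by auto
  have form: "b \<in> (\<lambda>q. cfg (Suc i) q u) ` UNIV" if "b \<in> Att" "amp machine w r b c \<noteq> 0" for b r
  proof -
    obtain j q v where b: "b = cfg j q v" using attainable_cfg \<open>b \<in> Att\<close> by metis
    show ?thesis using that(2) eq unfolding b
      by (auto simp: amp_cfg u_def split: if_splits)
  qed
  have inner: "(\<Sum>b\<in>Att. cnj (amp machine w r b c) * amp machine w r b c') =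
      (\<Sum>q\<in>UNIV. cnj (coef (Z i) (W ! i) p q r) * 
        (if i = i' \<and> u = act (Z i) p' (W ! i) s' then coef (Z i) (W ! i) p' q r else 0))"
    if r: "r \<in> {0, 1}" for r
  proof -
    have "(\<Sum>b\<in>Att. cnj (amp machine w r b c) * amp machine w r b c') =
      (\<Sum>b\<in>(\<lambda>q. cfg (Suc i) q u) ` UNIV. cnj (amp machine w r b c) * amp machine w r b c')"
      by (rule sum.mono_neutral_cong) (use form attainable_step[OF c(1) _ r] in \<open>auto\<close>)
    also have "\<dots> = (\<Sum>q\<in>UNIV. cnj (amp machine w r (cfg (Suc i) q u) c) * amp machine w r (cfg (Suc i) q u) c')"
      by (subst sum.reindex) (auto simp: inj_on_def)
    also have "\<dots> = (\<Sum>q\<in>UNIV. cnj (coef (Z i) (W ! i) p q r) * 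
        (if i = i' \<and> u = act (Z i) p' (W ! i) s' then coef (Z i) (W ! i) p' q r else 0))"
      using i unfolding eq(1) eq'(1) amp_cfg[OF eq(3,2)] amp_cfg[OF eq'(3,2)]
      by (intro sum.cong) (auto simp: u_def)
    finally show ?thesis .
  qed
  show ?thesis
  proof (cases "i = i' \<and> u = act (Z i) p' (W ! i) s'")
    case True
    have "(\<Sum>r\<in>{0, 1}. \<Sum>b\<in>Att. cnj (amp machine w r b c) * amp machine w r b c')
      = (\<Sum>r\<in>{0, 1}. \<Sum>q\<in>UNIV. cnj (coef (Z i) (W ! i) p q r) * coef (Z i) (W ! i) p' q r)"
      by (rule sum.cong[OF refl], subst inner) (use True in auto)
    also have "\<dots> = of_bool (p = p')"
      by (rule coef_orthonormal) (use True eq eq' in auto)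
    \<comment> \<open>Equal paths apply the same reversible tape operation, so equal images come
      from equal tapes.\<close>
    also have "p = p' \<longleftrightarrow> c = c'"
      using True eq(3) eq'(3) put_inj[of s s'] unfolding eq(1) eq'(1) u_def act_def by auto
    finally show ?thesis by simp
  next
    case False
    then have "c \<noteq> c'" by (auto simp: eq eq' u_def)
    moreover have "(\<Sum>b\<in>Att. cnj (amp machine w r b c) * amp machine w r b c') = 0" if "r \<in> {0, 1}" for r
      unfolding inner[OF that] using False by (intro sum.neutral) auto
    ultimately show ?thesis by simp
  qed
qed


text \<open>Outside the rejecting states the density matrix stays pure: register symbol 1 leads only to
  rejecting configurations, and these are never left.\<close>

primrec \<psi> :: "nat \<Rightarrow> (nat, nat) config \<Rightarrow> complex" where
  "\<psi> 0 c = of_bool (c = initial_config machine)"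
| "\<psi> (Suc n) c = (\<Sum>b\<in>Att. amp machine w 0 c b * \<psi> n b)"

declare \<psi>.simps(2) [simp del]

lemma amp_nonzero_pos: "amp machine w r c b \<noteq> 0 \<Longrightarrow> input_pos c = Suc (input_pos b)"
  unfolding amp_def by meson

lemma psi_pos: "\<psi> n c \<noteq> 0 \<Longrightarrow> input_pos c = n"
proof (induction n arbitrary: c)
  case 0
  then show ?case by (auto simp: initial_config_def split: if_splits)
next
  case (Suc n)
  from Suc.prems obtain b where "amp machine w 0 c b * \<psi> n b \<noteq> 0"
    unfolding \<psi>.simps by (rule sum.not_neutral_contains_not_neutral)
  with Suc.IH amp_nonzero_pos show ?case by fastforce
qed

lemma amp_1_Rej: "b \<in> Att \<Longrightarrow> c \<in> Att \<Longrightarrow> amp machine w 1 c b \<noteq> 0 \<Longrightarrow> \<exists>k. pth c = Rej k"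
proof -
  assume "b \<in> Att" "c \<in> Att" and amp: "amp machine w 1 c b \<noteq> 0"
  obtain i p s where "b = cfg i p s" "i \<le> N" "binary s"
    using attainable_cfg[OF \<open>b \<in> Att\<close>] .
  moreover obtain i' p' s' where "c = cfg i' p' s'"
    using attainable_cfg[OF \<open>c \<in> Att\<close>] .
  ultimately show ?thesis
    using amp by (cases p; cases p') (auto simp: amp_cfg split: if_splits)
qed

lemma amp_0_Rej: "b \<in> Att \<Longrightarrow> c \<in> Att \<Longrightarrow> amp machine w 0 c b \<noteq> 0 \<Longrightarrow> pth b \<noteq> Rej k"
proof -
  assume "b \<in> Att" "c \<in> Att" and amp: "amp machine w 0 c b \<noteq> 0"
  obtain i p s where "b = cfg i p s" "i \<le> N" "binary s"
    using attainable_cfg[OF \<open>b \<in> Att\<close>] .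
  moreover obtain i' p' s' where "c = cfg i' p' s'"
    using attainable_cfg[OF \<open>c \<in> Att\<close>] .
  ultimately show ?thesis
    using amp by (cases p; cases p') (auto simp: amp_cfg split: if_splits)
qed

text \<open>A configuration outside the rejecting states is reached only with register symbol 0 and
  only from such configurations, so a single matrix acts on that part of the state.\<close>

lemma density_psi:
  assumes "c \<in> Att" "c' \<in> Att" "\<And>k. pth c \<noteq> Rej k" "\<And>k. pth c' \<noteq> Rej k"
  shows "(evolve machine w ^^ n) (initial_density machine) c c' = \<psi> n c * cnj (\<psi> n c')"
  using assms
proof (induction n arbitrary: c c')
  case 0
  then show ?case by (simp add: initial_density_def)
next
  case (Suc n)
  let ?\<rho> = "(evolve machine w ^^ n) (initial_density machine)"
  have 1: "amp machine w 1 c b = 0" if "b \<in> Att" for b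
    using amp_1_Rej[OF that Suc.prems(1)] Suc.prems(3) by blast
  have "amp machine w 0 c b * ?\<rho> b b' * cnj (amp machine w 0 c' b')
      = (amp machine w 0 c b * \<psi> n b) * cnj (amp machine w 0 c' b' * \<psi> n b')"
    if "b \<in> Att" "b' \<in> Att" for b b'
  proof (cases "amp machine w 0 c b = 0 \<or> amp machine w 0 c' b' = 0")
    case False
    then have "?\<rho> b b' = \<psi> n b * cnj (\<psi> n b')"
      using that Suc.prems amp_0_Rej by (intro Suc.IH) metis+
    then show ?thesis by simp
  qed auto
  then have "(\<Sum>b\<in>Att. \<Sum>b'\<in>Att. amp machine w 0 c b * ?\<rho> b b' * cnj (amp machine w 0 c' b'))
      = (\<Sum>b\<in>Att. \<Sum>b'\<in>Att. (amp machine w 0 c b * \<psi> n b) * cnj (amp machine w 0 c' b' * \<psi> n b'))"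
    by (intro sum.cong refl)
  also have "\<dots> = \<psi> (Suc n) c * cnj (\<psi> (Suc n) c')"
    by (simp only: \<psi>.simps sum_product cnj_sum)
  finally have "(\<Sum>b\<in>Att. \<Sum>b'\<in>Att. amp machine w 0 c b * ?\<rho> b b' * cnj (amp machine w 0 c' b'))
      = \<psi> (Suc n) c * cnj (\<psi> (Suc n) c')" .
  moreover have "(evolve machine w ^^ Suc n) (initial_density machine) c c' = evolve machine w ?\<rho> c c'"
    by simp
  moreover have "evolve machine w \<rho> c c' =
      (\<Sum>b\<in>Att. \<Sum>b'\<in>Att. amp machine w 0 c b * \<rho> b b' * cnj (amp machine w 0 c' b'))" for \<rho>
    using 1 by (subst evolve_def) simp
  ultimately show ?case by (simp only:)
qed

lemma accept_prob_psi:
  "accept_prob machine w = (\<Sum>c | c \<in> Att \<and> cstate c \<in> accepting machine. (cmod (\<psi> N c))\<^sup>2)"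
proof -
  have "final_density machine w c c = of_real ((cmod (\<psi> N c))\<^sup>2)"
    if "c \<in> Att" "cstate c \<in> accepting machine" for c
  proof -
    have "pth c \<noteq> Rej k" for k
      using that(2) by (auto simp: pth_def accepting_machine)
    with that(1) show ?thesis
      unfolding final_density_def by (subst density_psi) (simp_all only: complex_norm_square not_False_eq_True simp_thms)
  qed
  then have "(\<Sum>c | c \<in> Att \<and> cstate c \<in> accepting machine. final_density machine w c c)
    = of_real (\<Sum>c | c \<in> Att \<and> cstate c \<in> accepting machine. (cmod (\<psi> N c))\<^sup>2)"
    by simp
  then show ?thesis by (simp add: accept_prob_def)
qed

text \<open>The matrices of both register symbols together act as an isometry on vectors supported
  in \<open>B\<close>; keeping only symbol 0 cannot increase the norm.\<close>

lemma norm_contraction: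
  assumes B: "B \<subseteq> Att" "\<And>b. b \<in> B \<Longrightarrow> input_pos b < N"
  shows "(\<Sum>c\<in>Att. (cmod (\<Sum>b\<in>B. amp machine w 0 c b * v b))\<^sup>2) \<le> (\<Sum>b\<in>B. (cmod (v b))\<^sup>2)"
proof -
  have fin: "finite B" using B(1) by (rule finite_subset) simp
  let ?X = "\<lambda>r c. \<Sum>b\<in>B. amp machine w r c b * v b"
  let ?f = "\<lambda>r c b b'. (v b * cnj (v b')) * (cnj (amp machine w r c b') * amp machine w r c b)"
  \<comment> \<open>Expand the squares and move the sums over \<open>r\<close> and \<open>c\<close>
    inside, where they form the entries fixed by well-formedness.\<close>
  have "complex_of_real (\<Sum>r\<in>{0, 1}. \<Sum>c\<in>Att. (cmod (?X r c))\<^sup>2) =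
      (\<Sum>r\<in>{0, 1}. \<Sum>c\<in>Att. \<Sum>b\<in>B. \<Sum>b'\<in>B. ?f r c b b')"
    by (simp only: of_real_sum complex_norm_square cnj_sum sum_product complex_cnj_mult mult_ac)
  also have "\<dots> = (\<Sum>r\<in>{0, 1}. \<Sum>b\<in>B. \<Sum>c\<in>Att. \<Sum>b'\<in>B. ?f r c b b')"
    by (rule sum.cong[OF refl], rule sum.swap)
  also have "\<dots> = (\<Sum>r\<in>{0, 1}. \<Sum>b\<in>B. \<Sum>b'\<in>B. \<Sum>c\<in>Att. ?f r c b b')"
    by (rule sum.cong[OF refl], rule sum.cong[OF refl], rule sum.swap)
  also have "\<dots> = (\<Sum>b\<in>B. \<Sum>r\<in>{0, 1}. \<Sum>b'\<in>B. \<Sum>c\<in>Att. ?f r c b b')"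
    by (rule sum.swap)
  also have "\<dots> = (\<Sum>b\<in>B. \<Sum>b'\<in>B. \<Sum>r\<in>{0, 1}. \<Sum>c\<in>Att. ?f r c b b')"
    by (rule sum.cong[OF refl], rule sum.swap)
  also have "\<dots> = (\<Sum>b\<in>B. \<Sum>b'\<in>B. (v b * cnj (v b')) * (if b' = b then 1 else 0))"
  proof (intro sum.cong refl)
    fix b b' assume "b \<in> B" "b' \<in> B"
    then have "(\<Sum>r\<in>{0, 1}. \<Sum>c\<in>Att. cnj (amp machine w r c b') * amp machine w r c b)
        = (if b' = b then 1 else 0)"
      using B by (intro well_formed_word) auto
    then show "(\<Sum>r\<in>{0, 1}. \<Sum>c\<in>Att. ?f r c b b') = (v b * cnj (v b')) * (if b' = b then 1 else 0)"
      by (simp only: sum_distrib_left[symmetric])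
  qed
  also have "\<dots> = (\<Sum>b\<in>B. v b * cnj (v b))"
    using fin by (intro sum.cong refl) (simp add: if_distrib sum.delta cong: if_cong)
  also have "\<dots> = complex_of_real (\<Sum>b\<in>B. (cmod (v b))\<^sup>2)"
    by (simp only: of_real_sum complex_norm_square)
  finally have "(\<Sum>r\<in>{0, 1}. \<Sum>c\<in>Att. (cmod (?X r c))\<^sup>2) = (\<Sum>b\<in>B. (cmod (v b))\<^sup>2)"
    by (simp only: of_real_eq_iff)
  moreover have "(\<Sum>r\<in>{0, 1}. \<Sum>c\<in>Att. (cmod (?X r c))\<^sup>2) \<ge> (\<Sum>c\<in>Att. (cmod (?X 0 c))\<^sup>2)"
    by (simp add: sum_nonneg)
  ultimately show ?thesis by linarith
qed

section \<open>Probability mass of each check\<close>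

definition branch :: "bool \<Rightarrow> (nat, nat) config set" where
  "branch k = {c \<in> Att. \<exists>x. pth c = Run k x}"

definition mass :: "bool \<Rightarrow> nat \<Rightarrow> real" where
  "mass k n = (\<Sum>c\<in>branch k. (cmod (\<psi> n c))\<^sup>2)"

lemma branch_Att: "branch k \<subseteq> Att" and finite_branch [simp]: "finite (branch k)"
  by (auto simp: branch_def)

text \<open>The checks never mix and rejecting paths never return; \<open>1 \<le> n\<close> excludes
  \<open>Init\<close>, the only other source.\<close>

lemma psi_Suc_branch:
  assumes "c \<in> branch k" "1 \<le> n"
  shows "\<psi> (Suc n) c = (\<Sum>b\<in>{b \<in> branch k. input_pos b = n}. amp machine w 0 c b * \<psi> n b)"
  unfolding \<psi>.simps
proof (rule sum.mono_neutral_right)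
  show "\<forall>b\<in>Att - {b \<in> branch k. input_pos b = n}. amp machine w 0 c b * \<psi> n b = 0"
  proof (rule ballI, rule ccontr)
    fix b assume b: "b \<in> Att - {b \<in> branch k. input_pos b = n}"
      and nz: "amp machine w 0 c b * \<psi> n b \<noteq> 0"
    then have n: "input_pos b = n" using psi_pos by auto
    obtain i p s where eq: "b = cfg i p s" "i \<le> N" "binary s" "i = 0 \<longleftrightarrow> p = Init"
      using b attainable_cfg by (metis DiffD1)
    obtain i' p' s' where c: "c = cfg i' p' s'"
      using assms(1) attainable_cfg branch_Att by blast
    obtain x where "p' = Run k x" using assms(1) by (auto simp: branch_def c)
    then show False
      using nz b n eq assms(2) by (cases p) (auto simp: c amp_cfg branch_def split: if_splits)
  qed
qed (auto simp: branch_def)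

lemma mass_Suc:
  assumes "1 \<le> n" "n < N"
  shows "mass k (Suc n) \<le> mass k n"
proof -
  let ?B = "{b \<in> branch k. input_pos b = n}"
  have "mass k (Suc n) = (\<Sum>c\<in>branch k. (cmod (\<Sum>b\<in>?B. amp machine w 0 c b * \<psi> n b))\<^sup>2)"
    unfolding mass_def using assms(1) by (intro sum.cong refl) (simp only: psi_Suc_branch)
  also have "\<dots> \<le> (\<Sum>c\<in>Att. (cmod (\<Sum>b\<in>?B. amp machine w 0 c b * \<psi> n b))\<^sup>2)"
    by (rule sum_mono2) (auto simp: branch_def)
  also have "\<dots> \<le> (\<Sum>b\<in>?B. (cmod (\<psi> n b))\<^sup>2)"
    by (rule norm_contraction) (use assms branch_Att in auto)
  also have "\<dots> \<le> mass k n"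
    unfolding mass_def by (rule sum_mono2) auto
  finally show ?thesis .
qed

lemma mass_antimono:
  assumes "1 \<le> m" "m \<le> n" "n \<le> N"
  shows "mass k n \<le> mass k m"
  using assms(2,3)
proof (induction n rule: dec_induct)
  case (step n)
  then show ?case using mass_Suc[of n k] assms(1) by simp
qed simp

lemma binary_tau: "i \<le> N \<Longrightarrow> binary (\<tau> k x i)"
proof (induction i)
  case 0
  show ?case by (simp add: tau_0 binary_def)
next
  case (Suc i)
  then show ?case by (simp add: tau_Suc binary_act)
qed

lemma tau_1: "\<tau> k x (Suc 0) = (\<lambda>_. Blank, 0)"
  using tau_Suc[OF N_pos] by (simp add: tau_0 W_0)

text \<open>A path that always keeps its label; the amplitude for this is 1/2 or 1. It witnesses
  that the deterministic configurations are attainable.\<close>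

definition path_cfg :: "bool \<Rightarrow> bool \<Rightarrow> nat \<Rightarrow> (nat, nat) config" where
  "path_cfg k x i = (if i = 0 then initial_config machine else cfg i (Run k x) (\<tau> k x i))"

lemma amp_path_cfg:
  assumes "i < N"
  shows "amp machine w 0 (path_cfg k x (Suc i)) (path_cfg k x i) \<noteq> 0"
proof (cases "i = 0")
  case True
  then show ?thesis
    using assms unfolding path_cfg_def initial_config_cfg
    by (simp add: amp_cfg tau_1 binary_def)
next
  case False
  then show ?thesis
    using assms by (simp add: path_cfg_def amp_cfg tau_Suc binary_tau)
qed

lemma path_cfg_attainable: "i \<le> N \<Longrightarrow> path_cfg k x i \<in> Att"
proof (induction i)
  case 0
  show ?case by (simp add: path_cfg_def initial_attainable)
next
  case (Suc i)
  then show ?case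
    using attainable_step[of "path_cfg k x i" 0] amp_path_cfg[of i k x] by simp
qed

lemma run_attainable: "1 \<le> i \<Longrightarrow> i \<le> N \<Longrightarrow> cfg i (Run k x) (\<tau> k x i) \<in> Att"
  using path_cfg_attainable[of i k x] by (simp add: path_cfg_def)

section \<open>Interference of the two paths of a check\<close>

definition two_paths :: "bool \<Rightarrow> nat \<Rightarrow> bool" where
  "two_paths k n \<longleftrightarrow> (\<forall>c\<in>branch k. \<psi> n c =
    of_bool (c = cfg n (Run k False) (\<tau> k False n)) / 2 + of_bool (c = cfg n (Run k True) (\<tau> k True n)) / 2)"

lemma two_paths_1: "two_paths k 1"
  unfolding two_paths_def
proof
  fix c assume c: "c \<in> branch k"
  then obtain i p s where eq: "c = cfg i p s" using branch_Att attainable_cfg by blast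
  with c obtain x where p: "p = Run k x" by (auto simp: branch_def)
  have "\<psi> (Suc 0) c = amp machine w 0 c (initial_config machine)"
    using initial_attainable
    by (simp add: \<psi>.simps(2) if_distrib sum.delta of_bool_def cong: if_cong)
  also have "\<dots> = (if i = 1 \<and> s = (\<lambda>_. Blank, 0) then 1/2 else 0)"
    using N_pos unfolding initial_config_cfg eq p by (subst amp_cfg) (auto simp: binary_def)
  finally show "\<psi> 1 c = of_bool (c = cfg 1 (Run k False) (\<tau> k False 1)) / 2 +
      of_bool (c = cfg 1 (Run k True) (\<tau> k True 1)) / 2"
    by (cases x) (auto simp: eq p tau_1)
qed

lemma psi_Suc_two_paths:
  assumes "two_paths k n" "1 \<le> n" "n < N" "c \<in> branch k"
  shows "\<psi> (Suc n) c = (amp machine w 0 c (cfg n (Run k False) (\<tau> k False n)) +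
    amp machine w 0 c (cfg n (Run k True) (\<tau> k True n))) / 2"
proof -
  let ?c = "\<lambda>x. cfg n (Run k x) (\<tau> k x n)"
  have "\<psi> (Suc n) c = (\<Sum>b\<in>{b \<in> branch k. input_pos b = n}. amp machine w 0 c b * \<psi> n b)"
    using psi_Suc_branch assms by blast
  also have "\<dots> = (\<Sum>b\<in>{?c False, ?c True}. amp machine w 0 c b * \<psi> n b)"
  proof (rule sum.mono_neutral_right)
    show "{?c False, ?c True} \<subseteq> {b \<in> branch k. input_pos b = n}"
      using assms run_attainable[of n k] by (auto simp: branch_def)
  qed (use assms(1) in \<open>auto simp: two_paths_def\<close>)
  also have "\<dots> = amp machine w 0 c (?c False) * \<psi> n (?c False) + amp machine w 0 c (?c True) * \<psi> n (?c True)"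
    by simp
  finally have eq: "\<psi> (Suc n) c = \<dots>" .
  have half: "\<psi> n (?c x) = 1/2" for x
  proof -
    have "?c x \<in> branch k"
      using assms run_attainable[of n k x] by (auto simp: branch_def)
    then show ?thesis
      using assms(1) unfolding two_paths_def by (cases x) (auto dest!: bspec)
  qed
  show ?thesis unfolding eq half by (simp add: add_divide_distrib)
qed

text \<open>On equal tapes a merge gives each label the amplitude (1/2 + 1/2)/2 = 1/2 again.\<close>

lemma two_paths_Suc:
  assumes "two_paths k n" "1 \<le> n" "n < N" "agree (run n) (W ! n) k"
  shows "two_paths k (Suc n)"
  unfolding two_paths_def
proof
  fix c assume c: "c \<in> branch k"
  then obtain i p s where eq: "c = cfg i p s" using branch_Att attainable_cfg by blast
  with c obtain x where p: "p = Run k x" by (auto simp: branch_def)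
  have "merges k (Z n) (W ! n) \<Longrightarrow> \<tau> k False n = \<tau> k True n"
    using assms(4) by (auto simp: agree_def Z_def \<tau>_def)
  then have "merges k (Z n) (W ! n) \<Longrightarrow> \<tau> k False (Suc n) = \<tau> k True (Suc n)"
    using assms(3) by (simp add: tau_Suc act_merges)
  then show "\<psi> (Suc n) c = of_bool (c = cfg (Suc n) (Run k False) (\<tau> k False (Suc n))) / 2 +
      of_bool (c = cfg (Suc n) (Run k True) (\<tau> k True (Suc n))) / 2"
    unfolding psi_Suc_two_paths[OF assms(1-3) c] unfolding eq p using assms(3)
    by (cases x) (auto simp: amp_cfg binary_tau tau_Suc)
qed

text \<open>Different tapes do not interfere: two labels on two tapes carry amplitude 1/2 * 1/2
  each, at most 4 * 1/16 in total.\<close>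

lemma mass_disagree:
  assumes "two_paths k n" "1 \<le> n" "n < N" "\<not> agree (run n) (W ! n) k"
  shows "mass k (Suc n) \<le> 1/4"
proof -
  have m: "merges k (Z n) (W ! n)" and ne: "\<tau> k False n \<noteq> \<tau> k True n"
    using assms(4) by (auto simp: agree_def Z_def \<tau>_def)
  let ?S = "(\<lambda>(x, y). cfg (Suc n) (Run k x) (\<tau> k y n)) ` UNIV"
  have psi: "\<psi> (Suc n) c = (if c \<in> ?S then 1/4 else 0)" if c: "c \<in> branch k" for c
  proof -
    obtain i p s where eq: "c = cfg i p s" using c branch_Att attainable_cfg by blast
    with c obtain x where p: "p = Run k x" by (auto simp: branch_def)
    show ?thesis
      unfolding psi_Suc_two_paths[OF assms(1-3) c]
      using m ne assms(3) by (auto simp: eq p amp_cfg binary_tau act_merges image_iff ex_bool_eq)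
  qed
  have "card ?S \<le> card (UNIV :: (bool \<times> bool) set)"
    by (rule card_image_le) simp
  then have card: "card (branch k \<inter> ?S) \<le> 4"
    using card_mono[of ?S "branch k \<inter> ?S"] by (simp add: card_UNIV_bool UNIV_Times_UNIV[symmetric] card_cartesian_product del: UNIV_Times_UNIV)
  have "mass k (Suc n) = (\<Sum>c\<in>branch k. if c \<in> ?S then 1/16 else 0)"
    unfolding mass_def by (intro sum.cong refl) (simp add: psi power2_eq_square norm_divide)
  also have "\<dots> = (\<Sum>c\<in>branch k \<inter> ?S. 1/16)"
    by (rule sum.inter_restrict[symmetric]) simp
  also have "\<dots> = real (card (branch k \<inter> ?S)) / 16" by simp
  also have "\<dots> \<le> 1/4" using card by linarith
  finally show ?thesis .
qed

lemma mass_le_half: assumes "1 \<le> n" "n \<le> N" shows "mass k n \<le> 1/2"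
proof -
  let ?S = "{cfg 1 (Run k False) (\<tau> k False 1), cfg 1 (Run k True) (\<tau> k True 1)}"
  have psi: "\<psi> 1 c = (if c \<in> ?S then 1/2 else 0)" if "c \<in> branch k" for c
    unfolding bspec[OF two_paths_1[unfolded two_paths_def] that] by auto
  have "card (branch k \<inter> ?S) \<le> card ?S"
    by (rule card_mono) auto
  also have "card ?S \<le> 2" by (simp add: card_insert_if)
  finally have card: "card (branch k \<inter> ?S) \<le> 2" .
  have "mass k 1 = (\<Sum>c\<in>branch k. if c \<in> ?S then 1/4 else 0)"
    unfolding mass_def by (intro sum.cong refl) (simp add: psi power2_eq_square norm_divide del: One_nat_def)
  also have "\<dots> = (\<Sum>c\<in>branch k \<inter> ?S. 1/4)"
    by (rule sum.inter_restrict[symmetric]) simp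
  also have "\<dots> = real (card (branch k \<inter> ?S)) / 4" by simp
  also have "\<dots> \<le> 1/2" using card by linarith
  finally show ?thesis using mass_antimono[of 1 n k] assms by simp
qed

section \<open>Acceptance probability of members and non-members\<close>

definition agrees :: bool where
  "agrees \<longleftrightarrow> (\<forall>i<N. \<forall>k. agree (run i) (W ! i) k)"

lemma accepting_cfg: "i \<le> N \<Longrightarrow> cstate (cfg i p s) \<in> accepting machine \<longleftrightarrow>
    ctrl_accepts (Z i) \<and> (\<exists>k x. p = Run k x)"
  using Z_in[of i] by (cases "Z i") (auto simp: accepting_machine cfg_def ctrl_accepts_def ctrls_def)

text \<open>A rejecting control gives probability 0. Otherwise some check meets a disagreement and
  keeps at most 1/4, while the other has at most 1/2.\<close>

lemma accept_prob_bound: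
  assumes "\<not> (agrees \<and> ctrl_accepts (Z N))"
  shows "accept_prob machine w \<le> 3/4"
proof (cases "ctrl_accepts (Z N)")
  case False
  have "\<psi> N c = 0" if c: "c \<in> Att" "cstate c \<in> accepting machine" for c
  proof (rule ccontr)
    assume "\<psi> N c \<noteq> 0"
    then have "input_pos c = N" by (rule psi_pos)
    then obtain p s where "c = cfg N p s" using c attainable_cfg by (metis input_pos_cfg)
    with c(2) False show False using accepting_cfg by auto
  qed
  then show ?thesis unfolding accept_prob_psi by simp
next
  case True
  with assms obtain i0 k0 where "i0 < N \<and> \<not> agree (run i0) (W ! i0) k0"
    by (auto simp: agrees_def)
  then obtain k where ex: "\<exists>i. i < N \<and> \<not> agree (run i) (W ! i) k" by blast
  \<comment> \<open>Up to its first disagreement the check is still in the superposition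
    \<open>two_paths\<close>, which \<open>mass_disagree\<close> requires.\<close>
  define i where "i = (LEAST i. i < N \<and> \<not> agree (run i) (W ! i) k)"
  have i: "i < N" "\<not> agree (run i) (W ! i) k"
    using LeastI_ex[OF ex] by (simp_all add: i_def)
  have before: "agree (run j) (W ! j) k" if "j < i" for j
    using not_less_Least[of j] that i(1) unfolding i_def by (metis (mono_tags, lifting) order_less_trans)
  have i1: "1 \<le> i"
    using i(2) W_0 by (cases i) (auto simp: agree_def merges_def)
  have "two_paths k j" if "1 \<le> j" "j \<le> i" for j
    using that
  proof (induction j rule: dec_induct)
    case base
    then show ?case using two_paths_1 by simp
  next
    case (step j)
    then show ?case using before i(1) by (intro two_paths_Suc) auto
  qed
  then have "mass k (Suc i) \<le> 1/4"
    using i i1 by (intro mass_disagree) auto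
  then have quarter: "mass k N \<le> 1/4"
    using mass_antimono[of "Suc i" N k] i(1) by simp
  have "accept_prob machine w \<le> (\<Sum>c\<in>branch k \<union> branch (\<not> k). (cmod (\<psi> N c))\<^sup>2)"
    unfolding accept_prob_psi
  proof (rule sum_mono2)
    show "{c \<in> Att. cstate c \<in> accepting machine} \<subseteq> branch k \<union> branch (\<not> k)"
    proof
      fix c assume c: "c \<in> {c \<in> Att. cstate c \<in> accepting machine}"
      then obtain k' x where "pth c = Run k' x" by (auto simp: pth_def accepting_machine)
      with c show "c \<in> branch k \<union> branch (\<not> k)" by (cases "k' = k") (auto simp: branch_def)
    qed
  qed auto
  also have "\<dots> = mass k N + mass (\<not> k) N"
    unfolding mass_def by (intro sum.union_disjoint) (auto simp: branch_def)
  also have "\<dots> \<le> 3/4"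
    using quarter mass_le_half[of N "\<not> k"] N_pos by simp
  finally show ?thesis .
qed

text \<open>Both checks stay in \<open>two_paths\<close> to the end, so four accepting
  configurations carry probability 1/4 each.\<close>

lemma accept_prob_member:
  assumes "agrees" "ctrl_accepts (Z N)"
  shows "accept_prob machine w = 1"
proof -
  have two: "two_paths k j" if "1 \<le> j" "j \<le> N" for j k
    using that
  proof (induction j rule: dec_induct)
    case base
    then show ?case using two_paths_1 by simp
  next
    case (step j)
    then show ?case using assms(1) by (intro two_paths_Suc) (auto simp: agrees_def)
  qed
  let ?S = "(\<lambda>(k, x). cfg N (Run k x) (\<tau> k x N)) ` UNIV"
  have N1: "1 \<le> N" using N_pos by linarith
  have psi: "\<psi> N c = (if c \<in> ?S then 1/2 else 0)" if c: "c \<in> Att" "cstate c \<in> accepting machine" for c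
  proof -
    obtain k x where "pth c = Run k x" using c(2) by (auto simp: pth_def accepting_machine)
    with c(1) have k: "c \<in> branch k" by (auto simp: branch_def)
    then have "c \<in> ?S \<longleftrightarrow> (\<exists>x. c = cfg N (Run k x) (\<tau> k x N))"
      by (auto simp: branch_def)
    then show ?thesis
      using two[OF N1 order.refl, of k] k by (auto simp: two_paths_def ex_bool_eq)
  qed
  have sub: "?S \<subseteq> {c \<in> Att. cstate c \<in> accepting machine}"
    using run_attainable[OF N1 order.refl] assms(2) by (auto simp: accepting_cfg)
  have "accept_prob machine w = (\<Sum>c | c \<in> Att \<and> cstate c \<in> accepting machine. if c \<in> ?S then 1/4 else 0)"
    unfolding accept_prob_psi
    by (intro sum.cong refl) (simp add: psi power2_eq_square norm_divide)
  also have "\<dots> = (\<Sum>c\<in>?S. 1/4)"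
    using sub by (intro sum.mono_neutral_cong_right) auto
  also have "\<dots> = real (card ?S) / 4" by simp
  also have "card ?S = card (UNIV :: (bool \<times> bool) set)"
    by (rule card_image) (auto simp: inj_on_def)
  finally show ?thesis
    by (simp add: UNIV_Times_UNIV[symmetric] card_cartesian_product del: UNIV_Times_UNIV)
qed

section \<open>Agreement on the whole input and the squares visited\<close>

lemma agrees_iff: "agrees \<longleftrightarrow> all_along agree_all step init_state W"
  by (simp add: agrees_def all_along_def agree_all_def run_def)

text \<open>\<open>one_step\<close> looks at single matrix entries, so configurations whose
  amplitudes cancel are attainable as well. A rejected path keeps its tape, so its head stays where
  some \<open>\<tau> k x\<close> had it.\<close>

lemma attainable_on_path:
  assumes "agrees" "c \<in> Att"
  obtains i k x where "i \<le> N" "wom_pos c = snd (\<tau> k x i)"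
proof -
  let ?P = "\<lambda>i p s. (p = Init \<longrightarrow> i = 0 \<and> s = \<tau> False False 0) \<and>
    (\<forall>k x. p = Run k x \<longrightarrow> s = \<tau> k x i) \<and> (\<forall>k. p = Rej k \<longrightarrow> (\<exists>x i'. i' \<le> N \<and> s = \<tau> k x i'))"
  have "(one_step machine w)\<^sup>*\<^sup>* (initial_config machine) c"
    using assms by (simp add: attainable_def)
  then have "\<exists>i p s. c = cfg i p s \<and> i \<le> N \<and> binary s \<and> ?P i p s"
  proof (induction rule: rtranclp_induct)
    case base
    then show ?case
      unfolding initial_config_cfg by (intro exI) (auto simp: binary_def tau_0)
  next
    case (step b c)
    then obtain i p s where b: "b = cfg i p s" "binary s" "?P i p s" by blast
    obtain p' r where c: "c = cfg (Suc i) p' (act (Z i) p (W ! i) s)"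
      "coef (Z i) (W ! i) p p' r \<noteq> 0" "i < N"
      using one_step_cfg[OF step.hyps(2)[unfolded b(1)] b(2)] .
    have same: "\<tau> k False i = \<tau> k True i" if "merges k (Z i) (W ! i)" for k
      using assms(1) c(3) that by (auto simp: agrees_def agree_def Z_def \<tau>_def)
    have "?P (Suc i) p' (act (Z i) p (W ! i) s)"
    proof (cases p)
      case Init
      with b(3) have "i = 0" "s = (\<lambda>_. Blank, 0)" by (auto simp: tau_0)
      with c(2) Init show ?thesis by (cases p') (auto simp: tau_1)
    next
      case (Run k x)
      with b(3) have s: "s = \<tau> k x i" by simp
      show ?thesis
      proof (cases "merges k (Z i) (W ! i)")
        case True
        then have "\<tau> k x' (Suc i) = \<tau> k x i" "act (Z i) p (W ! i) s = \<tau> k x i" for x'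
          using same[OF True] c(3) by (cases x; cases x'; simp add: tau_Suc act_merges Run s)+
        then show ?thesis
          using c(2,3) True by (cases p') (auto simp: Run split: if_splits intro: less_imp_le)
      next
        case False
        then show ?thesis
          using c(2,3) by (cases p') (auto simp: Run s tau_Suc split: if_splits)
      qed
    next
      case (Rej k)
      with b(3) c(2) show ?thesis by (cases p') (auto split: if_splits)
    qed
    then show ?case
      using c binary_act[OF b(2), of "Z i" p "W ! i"] by (intro exI[of _ "Suc i"] exI[of _ p'] exI) auto
  qed
  then obtain i p s where c: "c = cfg i p s" "i \<le> N" "?P i p s" by blast
  then have "\<exists>i k x. i \<le> N \<and> wom_pos c = snd (\<tau> k x i)"
    by (cases p) (auto simp: cfg_def)
  then show ?thesis using that by blast
qed

lemma wom_usage_le: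
  assumes "agrees" and near: "all_along (near B) step init_state W"
  shows "wom_usage machine w \<le> 2 * B + 1"
proof -
  have less: "\<bar>snd (\<tau> k x i)\<bar> \<le> int B" if "i < N" for i k x
    using near that by (simp add: all_along_def near_def \<tau>_def run_def)
  \<comment> \<open>The hypothesis covers the positions before each symbol; the last position
    repeats, as \<open>RightEnd\<close> moves no head.\<close>
  have le: "\<bar>snd (\<tau> k x i)\<bar> \<le> int B" if "i \<le> N" for i k x
  proof (cases "i = N")
    case True
    have N: "N = Suc (N - 1)" using N_pos by linarith
    have "W ! (N - 1) = RightEnd" by (simp add: padded_def nth_append)
    then have "\<tau> k x N = \<tau> k x (N - 1)"
      by (subst N, subst tau_Suc) (use N_pos in simp_all)
    then show ?thesis using less[of "N - 1"] N_pos True by simp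
  qed (use less that in simp)
  have card_le: "card (wom_pos ` set cs) \<le> 2 * B + 1" if cs: "comp_path machine w cs" for cs
  proof -
    have "cs ! i \<in> Att" if "i \<le> N" for i
      using that
    proof (induction i)
      case 0
      then show ?case using cs initial_attainable by (simp add: comp_path_def)
    next
      case (Suc i)
      then have "one_step machine w (cs ! i) (cs ! Suc i)" "cs ! i \<in> Att"
        using cs by (simp_all add: comp_path_def)
      then show ?case
        unfolding attainable_def by (auto intro: rtranclp.rtrancl_into_rtrancl)
    qed
    moreover have "length cs = Suc N" using cs by (simp add: comp_path_def)
    ultimately have "set cs \<subseteq> Att" by (auto simp: in_set_conv_nth)
    then have "wom_pos ` set cs \<subseteq> {- int B..int B}"
    proof (intro image_subsetI)
      fix c assume "set cs \<subseteq> Att" "c \<in> set cs"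
      then obtain i k x where "i \<le> N" "wom_pos c = snd (\<tau> k x i)"
        using attainable_on_path[OF assms(1)] by blast
      then show "wom_pos c \<in> {- int B..int B}" using le[of i k x] by auto
    qed
    then have "card (wom_pos ` set cs) \<le> card {- int B..int B}"
      by (rule card_mono[rotated]) simp
    then show ?thesis by simp
  qed
  \<comment> \<open>A computation path exists, so the maximum is taken over a nonempty set.\<close>
  have "comp_path machine w (map (path_cfg False False) [0..<Suc N])"
    unfolding comp_path_def
  proof (intro conjI allI impI)
    fix i assume "i < N"
    then have "amp machine w 0 (path_cfg False False (Suc i)) (path_cfg False False i) \<noteq> 0"
      by (rule amp_path_cfg)
    then have "one_step machine w (path_cfg False False i) (path_cfg False False (Suc i))"
      by (auto simp: one_step_def)
    then show "one_step machine w (map (path_cfg False False) [0..<Suc N] ! i)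
        (map (path_cfg False False) [0..<Suc N] ! Suc i)"
      using \<open>i < N\<close> by (simp only: nth_map_upt minus_nat.diff_0 add_0 Suc_less_eq less_SucI)
  qed (simp_all add: path_cfg_def nth_append del: upt_Suc)
  moreover have "finite {card (wom_pos ` set cs) | cs. comp_path machine w cs}"
    by (rule finite_subset[of _ "{..2 * B + 1}"]) (use card_le in auto)
  ultimately show ?thesis
    unfolding wom_usage_def using card_le by (subst Max_le_iff) auto
qed

end

lemma machine_is_rtqfa_wom: "is_rtqfa_wom machine"
proof -
  have "well_formed machine"
    unfolding well_formed_def using well_formed_word by (simp only: machine_simps) blast
  then show ?thesis
    by (auto simp: is_rtqfa_wom_def ctrls_def accepting_machine)
qed

subsection \<open>Members of the language\<close>

lemma member_iff: "w \<in> L_rev_bins \<longleftrightarrow> agrees w \<and> ctrl_accepts (Z w (N w))"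
proof -
  obtain ys r where w: "w = word_of ys r" by (rule word_of_cases)
  have ctrl: "ctrl_accepts (Z w (N w)) \<longleftrightarrow> 3 \<le> length ys \<and> r = []"
    using ctrl_final[of ys r] by (simp add: Z_def run_def w)
  have agr: "agrees w \<longleftrightarrow> ys = expected 0 [] (length ys)"
    unfolding agrees_iff w by (rule agree_all_padded)
  show ?thesis
  proof
    assume "agrees w \<and> ctrl_accepts (Z w (N w))"
    then have "r = []" "ys = expected 0 [] (length ys)" "3 \<le> length ys"
      using ctrl agr by auto
    then have "w = word_of (expected 0 [] (length ys)) []" using w by simp
    with \<open>3 \<le> length ys\<close> show "w \<in> L_rev_bins"
      unfolding L_rev_bins_eq by blast
  next
    assume "w \<in> L_rev_bins"
    then obtain n where n: "word_of ys r = word_of (expected 0 [] n) []" "3 \<le> n"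
      unfolding L_rev_bins_eq w by auto
    \<comment> \<open>Both criteria hold for every decomposition of the input, so they are evaluated
      at the one given by \<open>n\<close>.\<close>
    have "all_along agree_all step init_state (padded w)"
      unfolding w n(1) agree_all_padded by simp
    moreover have "ctrl_accepts (fst (foldl step init_state (padded w)))"
      unfolding w n(1) ctrl_final using n(2) by simp
    ultimately show "agrees w \<and> ctrl_accepts (Z w (N w))"
      by (simp add: agrees_iff Z_def run_def)
  qed
qed

lemma wom_usage_member:
  assumes "w \<in> L_rev_bins"
  shows "real (wom_usage machine w) \<le> 5 * log 2 (real (length w))"
proof -
  obtain n where w: "w = word_of (expected 0 [] n) []" and n: "3 \<le> n"
    using assms unfolding L_rev_bins_eq by auto
  \<comment> \<open>Each block satisfies \<open>2 ^ (length v - 1) \<le> length w\<close>, which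
    bounds its length by this number.\<close>
  define B where "B = nat \<lfloor>log 2 (real (length w))\<rfloor> + 1"
  have "n \<le> length w"
    using length_word_of[of "expected 0 [] n" "[]"] by (simp add: w length_expected)
  then have lw: "3 \<le> length w" using n by simp
  have log1: "1 \<le> log 2 (real (length w))"
    using lw by (subst le_log_iff) auto
  have "length v \<le> B" if "v \<in> set (expected 0 [] (Suc n))" for v
  proof -
    have "2 ^ (length v - 1) \<le> length w"
      using length_of_expected_word[OF that] n \<open>n \<le> length w\<close> by linarith
    then have "2 powr real (length v - 1) \<le> real (length w)"
      by (simp add: powr_realpow flip: of_nat_power_le_of_nat_cancel_iff)
    then have "real (length v - 1) \<le> log 2 (real (length w))"
      using lw by (subst le_log_iff) auto
    then show ?thesis unfolding B_def by linarith
  qed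
  then have "all_along (near B) step init_state (padded w)"
    unfolding w by (intro near_padded) auto
  then have "wom_usage machine w \<le> 2 * B + 1"
    using wom_usage_le member_iff assms by blast
  moreover have "real B \<le> log 2 (real (length w)) + 1"
    unfolding B_def using log1 by linarith
  \<comment> \<open>With l the logarithm, 2 B + 1 \<le> 2 l + 3 \<le> 5 l because l is at least
    1.\<close>
  ultimately show ?thesis using log1 by linarith
qed

theorem theorem7:
  shows "\<exists>M :: (nat, letter, nat, nat) rtqfa_wom.
    is_rtqfa_wom M \<and> input_alph M = {LA, L0, L1}
    \<and> recognizes_neg_one_sided M L_rev_bins (3/4)
    \<and> (\<lambda>w. real (wom_usage M w))
        \<in> O[inf (filtercomap length at_top) (principal L_rev_bins)](\<lambda>w. log 2 (real (length w)))"
proof (intro exI[of _ machine] conjI)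
  show "is_rtqfa_wom machine" by (rule machine_is_rtqfa_wom)
  show "input_alph machine = {LA, L0, L1}" by simp
  have "x \<in> {LA, L0, L1}" for x by (cases x) auto
  then have "w \<in> lists (input_alph machine)" for w by auto
  then show "recognizes_neg_one_sided machine L_rev_bins (3/4)"
    using member_iff accept_prob_member accept_prob_bound
    unfolding recognizes_neg_one_sided_def by auto
  show "(\<lambda>w. real (wom_usage machine w))
        \<in> O[inf (filtercomap length at_top) (principal L_rev_bins)](\<lambda>w. log 2 (real (length w)))"
  proof (rule bigoI)
    show "\<forall>\<^sub>F w in inf (filtercomap length at_top) (principal L_rev_bins).
        norm (real (wom_usage machine w)) \<le> 5 * norm (log 2 (real (length w)))"
      unfolding eventually_inf_principal
      using wom_usage_member by (intro always_eventually) fastforce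
  qed
qed

end
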